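(* Fix $\alpha,\beta\in(0,1)$ and $\gamma\ge1$ with $1/2<\beta<1$ and $1-\beta<\alpha<1/2$. Let $p_n\ge n$ with $p_n/n\to\gamma$, $r_n=n^{1-\beta}$, $\delta_n=n^{-\alpha}$; write $p=p_n$, $r=r_n$, $\delta=\delta_n$. Let $\eta\in\{0,1\}^p$ have exactly $r$ nonzero entries, let $\widetilde Q=[q_1,\dots,q_p]$ be a uniformly distributed random $p\times p$ orthogonal matrix, and let the transmitted vectors be $$X_i=\sqrt{\tfrac{\delta}{1-\delta}}\sum_{k:\,\eta(k)=1}z_{ik}\,q_k+Z_i,\qquad 1\le i\le n,$$ where $z_{ik}\stackrel{iid}{\sim}N(0,1)$ and $Z_i\stackrel{iid}{\sim}N(0,I_p)$ are independent of each other and of $\widetilde Q$. Then, as $n\to\infty$: (i) ("friends", who observe $X_1,\dots,X_n$ and know $\widetilde Q$) the vector $\eta$ can be decoded exactly with high probability: there are decoders $\hat\eta_n=\hat\eta_n(X_1,\dots,X_n,\widetilde Q)\in\{0,1\}^p$, not depending on $\eta$, with $\inf_{\eta}P(\hat\eta_n=\eta)\to1$, the infimum being over all $\eta\in\{0,1\}^p$ with exactly $r$ nonzero entries; (ii) ("enemy", who observes only $X_1,\dots,X_n$ and not $\widetilde Q$) the signal cannot be distinguished from white noise: for testing the null $X_i\stackrel{iid}{\sim}N(0,I_p)$ against the alternative that $X_i=\sqrt{\tfrac{\delta}{1-\delta}}\sum_{k:\,\eta(k)=1}z_{ik}\,q_k+Z_i$ for $1\le i\le n$, with $z_{ik}\stackrel{iid}{\sim}N(0,1)$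 and $Z_i\stackrel{iid}{\sim}N(0,I_p)$ independent of each other and of the uniformly distributed random orthogonal matrix $\widetilde Q=[q_1,\dots,q_p]$, the infimum over all tests based on $X_1,\dots,X_n$ of the sum of Type I and Type II errors tends to $1$.
   Context: With $Q$ the $p\times r$ matrix with columns $\{q_k:\eta(k)=1\}$, conditionally on $\widetilde Q$ the $X_i$ are i.i.d. $N\big(0,I_p+\frac{\delta}{1-\delta}QQ'\big)$, and $Q$ is uniformly distributed on the Stiefel manifold $\{Q\in\mathbb{R}^{p\times r}:Q'Q=I_r\}$. $r_n=n^{1-\beta}$ is understood as rounded to an integer. "Uniformly distributed orthogonal matrix" means Haar distributed on the orthogonal group. The Type I error of a test is its rejection probability under the null; the Type II error is its acceptance probability under the alternative (averaging over $\widetilde Q$). *)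

theory Defs
  imports "HOL-Probability.Probability"
begin

text \<open>
  Dimensions vary with the sample size, so an \<open>m \<times> k\<close> real matrix is an extensional function on the
  index set \<open>{..<m} \<times> {..<k}\<close>, with row index first. A sample \<open>X\<^sub>1, \<dots>, X\<^sub>n\<close> of vectors in
  \<open>p\<close>-space is the \<open>n \<times> p\<close> matrix whose rows are the observations.
\<close>

abbreviation mat_space :: "nat \<Rightarrow> nat \<Rightarrow> (nat \<times> nat \<Rightarrow> real) measure" where
  "mat_space m k \<equiv> PiM ({..<m} \<times> {..<k}) (\<lambda>_. borel)"

definition gaussian_mat :: "nat \<Rightarrow> nat \<Rightarrow> (nat \<times> nat \<Rightarrow> real) measure" where
  "gaussian_mat m k = PiM ({..<m} \<times> {..<k}) (\<lambda>_. density lborel (\<lambda>x. ennreal (std_normal_density x)))"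

definition sq_mat_mult ::
  "nat \<Rightarrow> (nat \<times> nat \<Rightarrow> real) \<Rightarrow> (nat \<times> nat \<Rightarrow> real) \<Rightarrow> (nat \<times> nat \<Rightarrow> real)" where
  "sq_mat_mult p A B = (\<lambda>(i, j) \<in> {..<p} \<times> {..<p}. \<Sum>k<p. A (i, k) * B (k, j))"

definition orthogonal_group :: "nat \<Rightarrow> (nat \<times> nat \<Rightarrow> real) set" where
  "orthogonal_group p =
     {Q \<in> extensional ({..<p} \<times> {..<p}).
        \<forall>i<p. \<forall>j<p. (\<Sum>k<p. Q (k, i) * Q (k, j)) = (if i = j then 1 else 0)}"

text \<open>
  The normalised (left) Haar measure on the orthogonal group, viewed as a measure on all
  \<open>p \<times> p\<close> matrices that is concentrated on the group. The group is compact, so such a measure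
  exists, is unique, and is right-invariant too.
\<close>

definition is_haar_orthogonal :: "nat \<Rightarrow> (nat \<times> nat \<Rightarrow> real) measure \<Rightarrow> bool" where
  "is_haar_orthogonal p H \<longleftrightarrow>
     prob_space H \<and> sets H = sets (mat_space p p) \<and>
     (AE Q in H. Q \<in> orthogonal_group p) \<and>
     (\<forall>G \<in> orthogonal_group p. distr H (mat_space p p) (sq_mat_mult p G) = H)"

definition binary_vecs :: "nat \<Rightarrow> (nat \<Rightarrow> nat) set" where
  "binary_vecs p = {..<p} \<rightarrow>\<^sub>E {0, 1}"

definition sparse_binary_vecs :: "nat \<Rightarrow> nat \<Rightarrow> (nat \<Rightarrow> nat) set" where
  "sparse_binary_vecs p r = {\<eta> \<in> binary_vecs p. card {k \<in> {..<p}. \<eta> k \<noteq> 0} = r}"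

text \<open>
  The randomness of the model is a triple \<open>(Q, z, Z)\<close> of independent components; \<open>H\<close> is the law
  of the random orthogonal matrix \<open>Q\<close>, whose \<open>k\<close>-th column is \<open>q\<^sub>k\<close>.
\<close>

type_synonym randomness =
  "(nat \<times> nat \<Rightarrow> real) \<times> (nat \<times> nat \<Rightarrow> real) \<times> (nat \<times> nat \<Rightarrow> real)"

definition model :: "nat \<Rightarrow> nat \<Rightarrow> (nat \<times> nat \<Rightarrow> real) measure \<Rightarrow> randomness measure" where
  "model n p H = H \<Otimes>\<^sub>M (gaussian_mat n p \<Otimes>\<^sub>M gaussian_mat n p)"

definition transmitted :: "nat \<Rightarrow> nat \<Rightarrow> real \<Rightarrow> (nat \<Rightarrow> nat) \<Rightarrow> randomness \<Rightarrow> (nat \<times> nat \<Rightarrow> real)" where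
  "transmitted n p \<delta> \<eta> = (\<lambda>(Q, z, Z). \<lambda>(i, j) \<in> {..<n} \<times> {..<p}.
     sqrt (\<delta> / (1 - \<delta>)) * (\<Sum>k \<in> {k \<in> {..<p}. \<eta> k = 1}. z (i, k) * Q (j, k)) + Z (i, j))"

definition decoders :: "nat \<Rightarrow> nat \<Rightarrow> ((nat \<times> nat \<Rightarrow> real) \<times> (nat \<times> nat \<Rightarrow> real) \<Rightarrow> nat \<Rightarrow> nat) set" where
  "decoders n p = (mat_space n p \<Otimes>\<^sub>M mat_space p p) \<rightarrow>\<^sub>M count_space (binary_vecs p)"

definition success_prob ::
  "nat \<Rightarrow> nat \<Rightarrow> (nat \<times> nat \<Rightarrow> real) measure \<Rightarrow> real \<Rightarrow>
   ((nat \<times> nat \<Rightarrow> real) \<times> (nat \<times> nat \<Rightarrow> real) \<Rightarrow> nat \<Rightarrow> nat) \<Rightarrow> (nat \<Rightarrow> nat) \<Rightarrow> real" where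
  "success_prob n p H \<delta> dec \<eta> =
     measure (model n p H)
       {\<omega> \<in> space (model n p H). dec (transmitted n p \<delta> \<eta> \<omega>, fst \<omega>) = \<eta>}"

definition null_law :: "nat \<Rightarrow> nat \<Rightarrow> (nat \<times> nat \<Rightarrow> real) measure" where
  "null_law n p = gaussian_mat n p"

definition alternative_law ::
  "nat \<Rightarrow> nat \<Rightarrow> (nat \<times> nat \<Rightarrow> real) measure \<Rightarrow> real \<Rightarrow> (nat \<Rightarrow> nat) \<Rightarrow> (nat \<times> nat \<Rightarrow> real) measure" where
  "alternative_law n p H \<delta> \<eta> = distr (model n p H) (mat_space n p) (transmitted n p \<delta> \<eta>)"

text \<open>
  A test may be randomised: \<open>\<phi> x\<close> is the probability of rejecting the null when \<open>x\<close> is observed.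
  Non-randomised tests are the indicator functions of rejection regions.
\<close>

definition tests :: "nat \<Rightarrow> nat \<Rightarrow> ((nat \<times> nat \<Rightarrow> real) \<Rightarrow> real) set" where
  "tests n p = {\<phi> \<in> borel_measurable (mat_space n p). \<forall>x \<in> space (mat_space n p). 0 \<le> \<phi> x \<and> \<phi> x \<le> 1}"

definition type_I_error :: "nat \<Rightarrow> nat \<Rightarrow> ((nat \<times> nat \<Rightarrow> real) \<Rightarrow> real) \<Rightarrow> real" where
  "type_I_error n p \<phi> = (LINT x|null_law n p. \<phi> x)"

definition type_II_error ::
  "nat \<Rightarrow> nat \<Rightarrow> (nat \<times> nat \<Rightarrow> real) measure \<Rightarrow> real \<Rightarrow> (nat \<Rightarrow> nat) \<Rightarrow>
   ((nat \<times> nat \<Rightarrow> real) \<Rightarrow> real) \<Rightarrow> real" where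
  "type_II_error n p H \<delta> \<eta> \<phi> = (LINT x|alternative_law n p H \<delta> \<eta>. 1 - \<phi> x)"

lemma transmitted_measurable:
  assumes "is_haar_orthogonal p H"
  shows "transmitted n p \<delta> \<eta> \<in> model n p H \<rightarrow>\<^sub>M mat_space n p"
proof -
  have g: "sets (gaussian_mat n p) = sets (mat_space n p)"
    unfolding gaussian_mat_def by (intro sets_PiM_cong) auto
  have m: "sets (model n p H) =
      sets (mat_space p p \<Otimes>\<^sub>M (mat_space n p \<Otimes>\<^sub>M mat_space n p))"
    using assms g unfolding model_def is_haar_orthogonal_def
    by (intro sets_pair_measure_cong) auto
  show ?thesis
    unfolding measurable_cong_sets[OF m refl] transmitted_def case_prod_beta
    by (rule measurable_restrict) (auto intro!: borel_measurable_add borel_measurable_times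
      borel_measurable_sum borel_measurable_const
      measurable_compose[OF measurable_fst measurable_component_singleton]
      measurable_compose[OF measurable_compose[OF measurable_snd measurable_fst] measurable_component_singleton]
      measurable_compose[OF measurable_compose[OF measurable_snd measurable_snd] measurable_component_singleton])
qed

end

theory Submission
  imports Defs "HOL-Real_Asymp.Real_Asymp"
begin

text \<open>
  (i) Given \<open>Q\<close>, the coordinates \<open>\<langle>X\<^sub>i, q\<^sub>k\<rangle>\<close> are independent over \<open>i\<close>, with variance \<open>1 + a\<close>
  (\<open>a = \<delta> / (1 - \<delta>)\<close>) or \<open>1\<close> according to \<open>\<eta>(k)\<close>. Testing each coordinate by its likelihood ratio
  against \<open>1\<close>, both error probabilities are at most the Hellinger affinity, here
  \<open>(1 - a\<^sup>2 / (2 + a)\<^sup>2)\<close> to the power \<open>n / 4\<close>; since \<open>n a\<^sup>2\<close> grows polynomially, a union bound over the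
  \<open>p\<close> coordinates suffices.

  (ii) Haar measure is right-invariant, so \<open>Q\<close> may be replaced by \<open>Q G\<close> for any convenient
  independent random orthogonal \<open>G\<close>. Choose \<open>G\<close> such that the columns selected by \<open>\<eta>\<close> are normalised
  random sign vectors supported on \<open>r\<close> disjoint blocks of size at least \<open>m = p div r\<close>. Even when \<open>Q\<close> is revealed,
  the second moment of the likelihood ratio then factorises over the blocks and is at most
  \<open>exp (2 r n a\<^sup>2 / m)\<close>, with exponent of order \<open>r\<^sup>2 a\<^sup>2\<close>, which tends to \<open>0\<close> because
  \<open>1 - \<beta> < \<alpha>\<close>.
\<close>

subsection \<open>Gaussian integrals\<close>

text \<open>A direct second moment for a Haar frame involves all overlaps between the columns of two
  independent frames, which are strongly dependent. Right multiplication by \<open>G\<close> trades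
  them for coin tosses. Once both replicas share the same revealed \<open>Q\<close>, inner products
  no longer see \<open>Q\<close>; since the blocks are disjoint, the overlap matrix of two sign
  frames is diagonal, and its entries are averages of independent signs. Revealing \<open>Q\<close>
  can only help a test, so a bound for each fixed orthogonal \<open>Q\<close> suffices.

  The coefficients \<open>z\<close> are kept, together with the signs, as part of a random mean. The
  alternative is then a mixture of translates of white noise, and one-dimensional Gaussian integrals
  replace all determinants. The squared overlap on a block has mean at most \<open>1 / m\<close>, so
  each of the \<open>r\<close> blocks contributes about \<open>n a^2 / m\<close> to the exponent;
  since \<open>m\<close> is about \<open>p / r\<close> and \<open>n \<le> p\<close>, the total is of
  order \<open>r^2 a^2\<close>.\<close>

abbreviation std_gauss :: "real measure" where
  "std_gauss \<equiv> density lborel (\<lambda>x. ennreal (std_normal_density x))"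

abbreviation gauss :: "'i set \<Rightarrow> ('i \<Rightarrow> real) measure" where
  "gauss I \<equiv> PiM I (\<lambda>_. std_gauss)"

lemma prob_space_std_gauss: "prob_space std_gauss"
  by (rule prob_space_normal_density) simp

interpretation std_gauss: prob_space std_gauss
  by (rule prob_space_std_gauss)

interpretation gauss: product_prob_space "\<lambda>_. std_gauss" I for I
  by unfold_locales

lemma sets_gauss [measurable_cong]: "sets (gauss I) = sets (PiM I (\<lambda>_. borel))"
  by (intro sets_PiM_cong) auto

text \<open>Completing the square: the tilted density is \<open>K\<close> times the normal density
  with mean \<open>b / (1 + c)\<close> and variance \<open>1 / (1 + c)\<close>. The case
  \<open>c = 0\<close> gives the moment generating function, negative \<open>c\<close> the
  exponential moments of squares, and \<open>c = a\<close> the likelihood ratio of a spike.\<close>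

lemma std_gauss_exp_quadratic:
  assumes "c > -1"
  shows "(\<integral>\<^sup>+x. ennreal (exp (b * x - c * x\<^sup>2 / 2)) \<partial>std_gauss) =
    ennreal (exp (b\<^sup>2 / (2 * (1 + c))) / sqrt (1 + c))"
proof -
  define s where "s = 1 / sqrt (1 + c)"
  have s: "s > 0" "s\<^sup>2 = 1 / (1 + c)" using assms by (auto simp: s_def power_divide)
  define K where "K = exp (b\<^sup>2 / (2 * (1 + c))) * s"
  have K: "K \<ge> 0" using s by (simp add: K_def)
  have eq: "std_normal_density x * exp (b * x - c * x\<^sup>2 / 2) = K * normal_density (b / (1 + c)) s x" for x
  proof -
    have e: "- x\<^sup>2 / 2 + (b * x - c * x\<^sup>2 / 2) =
      b\<^sup>2 / (2 * (1 + c)) + (- (x - b / (1 + c))\<^sup>2 / (2 * s\<^sup>2))"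
    proof -
      define y where "y = b / (1 + c)"
      have b: "b = (1 + c) * y" using assms by (simp add: y_def)
      have "b\<^sup>2 / (2 * (1 + c)) = (1 + c) * y\<^sup>2 / 2"
        using assms unfolding b by (simp add: power2_eq_square field_simps)
      then show ?thesis
        unfolding s(2) y_def[symmetric] by (simp add: b field_simps power2_eq_square)
    qed
    have "std_normal_density x * exp (b * x - c * x\<^sup>2 / 2) =
      1 / sqrt (2 * pi) * exp (- x\<^sup>2 / 2 + (b * x - c * x\<^sup>2 / 2))"
      by (simp only: std_normal_density_def exp_add mult.assoc)
    also have "\<dots> = 1 / sqrt (2 * pi) * exp (b\<^sup>2 / (2 * (1 + c))) * exp (- (x - b / (1 + c))\<^sup>2 / (2 * s\<^sup>2))"
      unfolding e exp_add by simp
    also have "\<dots> = K * normal_density (b / (1 + c)) s x"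
      using s(1) by (simp add: K_def normal_density_def real_sqrt_mult)
    finally show ?thesis .
  qed
  have "(\<integral>\<^sup>+x. ennreal (exp (b * x - c * x\<^sup>2 / 2)) \<partial>std_gauss) =
    (\<integral>\<^sup>+x. ennreal K * ennreal (normal_density (b / (1 + c)) s x) \<partial>lborel)"
    by (subst nn_integral_density) (auto simp flip: ennreal_mult eq simp: K ennreal_mult'[symmetric])
  also have "\<dots> = ennreal K"
    using s(1) by (subst nn_integral_cmult) (auto simp: nn_integral_eq_integral)
  finally show ?thesis by (simp add: K_def s_def)
qed

lemma std_gauss_shift:
  assumes [measurable]: "f \<in> borel_measurable borel"
  shows "(\<integral>\<^sup>+x. f (x + m) \<partial>std_gauss) = (\<integral>\<^sup>+x. f x * ennreal (exp (m * x - m\<^sup>2 / 2)) \<partial>std_gauss)"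
proof -
  have e: "std_normal_density (x - m) = std_normal_density x * exp (m * x - m\<^sup>2 / 2)" for x
    by (simp add: std_normal_density_def power2_eq_square field_simps flip: exp_add)
  have "(\<integral>\<^sup>+x. f (x + m) \<partial>std_gauss) = (\<integral>\<^sup>+x. ennreal (std_normal_density x) * f (x + m) \<partial>lborel)"
    by (subst nn_integral_density) auto
  also have "\<dots> = (\<integral>\<^sup>+x. ennreal (std_normal_density (x - m)) * f x \<partial>lborel)"
    by (subst nn_integral_real_affine[where c = 1 and t = "-m"]) auto
  also have "\<dots> = (\<integral>\<^sup>+x. f x * ennreal (exp (m * x - m\<^sup>2 / 2)) \<partial>std_gauss)"
    unfolding e by (subst nn_integral_density) (auto simp: ennreal_mult' mult_ac)
  finally show ?thesis .
qed

lemma gauss_exp_quadratic: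
  assumes "finite I" "\<And>i. i \<in> I \<Longrightarrow> c i > -1"
  shows "(\<integral>\<^sup>+x. ennreal (exp (\<Sum>i\<in>I. b i * x i - c i * (x i)\<^sup>2 / 2)) \<partial>gauss I) =
    ennreal (\<Prod>i\<in>I. exp ((b i)\<^sup>2 / (2 * (1 + c i))) / sqrt (1 + c i))"
proof -
  have "(\<integral>\<^sup>+x. ennreal (exp (\<Sum>i\<in>I. b i * x i - c i * (x i)\<^sup>2 / 2)) \<partial>gauss I) =
    (\<integral>\<^sup>+x. (\<Prod>i\<in>I. ennreal (exp (b i * x i - c i * (x i)\<^sup>2 / 2))) \<partial>gauss I)"
    using assms by (simp add: exp_sum prod_ennreal)
  also have "\<dots> = (\<Prod>i\<in>I. \<integral>\<^sup>+x. ennreal (exp (b i * x - c i * x\<^sup>2 / 2)) \<partial>std_gauss)"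
    using assms by (intro gauss.product_nn_integral_prod) auto
  also have "\<dots> = (\<Prod>i\<in>I. ennreal (exp ((b i)\<^sup>2 / (2 * (1 + c i))) / sqrt (1 + c i)))"
    using assms by (intro prod.cong refl std_gauss_exp_quadratic) auto
  also have "\<dots> = ennreal (\<Prod>i\<in>I. exp ((b i)\<^sup>2 / (2 * (1 + c i))) / sqrt (1 + c i))"
    using assms by (intro prod_ennreal divide_nonneg_nonneg) (auto simp: less_imp_le dest!: assms(2))
  finally show ?thesis .
qed

lemma gauss_exp_linear:
  assumes "finite I"
  shows "(\<integral>\<^sup>+x. ennreal (exp (\<Sum>i\<in>I. b i * x i)) \<partial>gauss I) = ennreal (exp ((\<Sum>i\<in>I. (b i)\<^sup>2) / 2))"
  using gauss_exp_quadratic[of I "\<lambda>_. 0" b] assms by (simp add: exp_sum sum_divide_distrib)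

text \<open>The Cameron-Martin formula, one coordinate at a time. The induction must be general in
  \<open>f\<close>, because its hypothesis is applied to \<open>f\<close> with the coordinate
  \<open>j\<close> frozen.\<close>

lemma gauss_shift:
  assumes "finite I" and "f \<in> borel_measurable (PiM I (\<lambda>_. borel))"
  shows "(\<integral>\<^sup>+x. f (\<lambda>i\<in>I. x i + m i) \<partial>gauss I) =
    (\<integral>\<^sup>+x. f x * ennreal (exp (\<Sum>i\<in>I. m i * x i - (m i)\<^sup>2 / 2)) \<partial>gauss I)"
  using assms
proof (induction I arbitrary: f)
  case empty
  then show ?case by (simp add: nn_integral_count_space_finite PiM_empty)
next
  case (insert j I)
  note [measurable] = insert.prems
  have 1: "(\<integral>\<^sup>+x. f (\<lambda>i\<in>insert j I. x i + m i) \<partial>gauss (insert j I)) = 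
     (\<integral>\<^sup>+y. (\<integral>\<^sup>+x. f ((\<lambda>i\<in>I. x i + m i)(j := y + m j)) \<partial>gauss I) \<partial>std_gauss)"
  proof -
    have "(\<lambda>i\<in>insert j I. (x(j:=y)) i + m i) = (\<lambda>i\<in>I. x i + m i)(j := y + m j)" for x y
      using insert.hyps by (auto simp: restrict_def fun_eq_iff)
    then show ?thesis
      using insert.hyps by (subst gauss.product_nn_integral_insert_rev) auto
  qed
  also have "\<dots> = (\<integral>\<^sup>+y. (\<integral>\<^sup>+x. f (x(j := y + m j)) * ennreal (exp (\<Sum>i\<in>I. m i * x i - (m i)\<^sup>2 / 2)) \<partial>gauss I) \<partial>std_gauss)"
    using insert.hyps by (subst insert.IH[symmetric]) auto
  also have "\<dots> = (\<integral>\<^sup>+y. (\<integral>\<^sup>+x. f (x(j := y)) * ennreal (exp (\<Sum>i\<in>I. m i * x i - (m i)\<^sup>2 / 2)) \<partial>gauss I)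
      * ennreal (exp (m j * y - (m j)\<^sup>2 / 2)) \<partial>std_gauss)"
    by (subst std_gauss_shift[symmetric]) auto
  also have "\<dots> = (\<integral>\<^sup>+y. (\<integral>\<^sup>+x. f (x(j := y)) * ennreal (exp (\<Sum>i\<in>I. m i * x i - (m i)\<^sup>2 / 2))
      * ennreal (exp (m j * y - (m j)\<^sup>2 / 2)) \<partial>gauss I) \<partial>std_gauss)"
    by (intro nn_integral_cong nn_integral_multc[symmetric]) auto
  also have "\<dots> = (\<integral>\<^sup>+x. f x * ennreal (exp (\<Sum>i\<in>insert j I. m i * x i - (m i)\<^sup>2 / 2)) \<partial>gauss (insert j I))"
  proof -
    have "(\<Sum>i\<in>I. m i * (if i = j then y else x i) - (m i)\<^sup>2 / 2) = (\<Sum>i\<in>I. m i * x i - (m i)\<^sup>2 / 2)" for x y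
      using insert.hyps by (intro sum.cong) auto
    then show ?thesis
      using insert.hyps
      by (subst gauss.product_nn_integral_insert_rev)
         (auto simp: exp_add ennreal_mult' mult_ac intro!: nn_integral_cong)
  qed
  finally show ?case .
qed

subsection \<open>Haar measure and block sign frames\<close>

definition mat_transpose :: "nat \<Rightarrow> (nat \<times> nat \<Rightarrow> real) \<Rightarrow> (nat \<times> nat \<Rightarrow> real)" where
  "mat_transpose p Q = (\<lambda>(i, j) \<in> {..<p} \<times> {..<p}. Q (j, i))"

lemma measurable_mat_transpose [measurable]:
  "mat_transpose p \<in> mat_space p p \<rightarrow>\<^sub>M mat_space p p"
  unfolding mat_transpose_def case_prod_beta
  by (rule measurable_restrict) (auto intro: measurable_component_singleton)

lemma measurable_sq_mat_mult [measurable (raw)]: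
  assumes "f \<in> N \<rightarrow>\<^sub>M mat_space p p" "g \<in> N \<rightarrow>\<^sub>M mat_space p p"
  shows "(\<lambda>x. sq_mat_mult p (f x) (g x)) \<in> N \<rightarrow>\<^sub>M mat_space p p"
  unfolding sq_mat_mult_def case_prod_beta
  by (rule measurable_restrict)
     (auto intro!: borel_measurable_sum borel_measurable_times
       measurable_compose[OF assms(1) measurable_component_singleton]
       measurable_compose[OF assms(2) measurable_component_singleton])

lemma transpose_sq_mat_mult:
  "mat_transpose p (sq_mat_mult p A B) = sq_mat_mult p (mat_transpose p B) (mat_transpose p A)"
  by (auto simp: mat_transpose_def sq_mat_mult_def fun_eq_iff mult.commute intro!: sum.cong)

lemma transpose_transpose:
  "Q \<in> extensional ({..<p} \<times> {..<p}) \<Longrightarrow> mat_transpose p (mat_transpose p Q) = Q"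
  by (auto simp: mat_transpose_def fun_eq_iff extensional_def)

text \<open>The group is defined by \<open>Q^T Q = I\<close>, and \<open>Q Q^T = I\<close> follows
  by a Frobenius norm computation. With \<open>P = Q Q^T\<close>, both \<open>tr P\<close> and
  \<open>tr (P^2) = tr ((Q^T Q)^2)\<close> equal \<open>p\<close>, so the squared norm of
  \<open>I - P\<close> is \<open>p - 2 p + p = 0\<close>. No inverse or determinant is
  involved.\<close>

lemma orthogonal_group_rows:
  assumes Q: "Q \<in> orthogonal_group p" and ij: "i < p" "j < p"
  shows "(\<Sum>k<p. Q (i, k) * Q (j, k)) = (if i = j then 1 else 0)"
proof -
  define P where "P i j = (\<Sum>k<p. Q (i, k) * Q (j, k))" for i j
  define d where "d i j = (if i = j then 1 else 0 :: real)" for i j :: nat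
  have col: "(\<Sum>k<p. Q (k, i) * Q (k, j)) = d i j" if "i < p" "j < p" for i j
    using Q that by (auto simp: orthogonal_group_def d_def)
  have "(\<Sum>i<p. \<Sum>j<p. (P i j)\<^sup>2) = (\<Sum>i<p. \<Sum>j<p. \<Sum>k<p. \<Sum>l<p. Q (i, k) * Q (j, k) * (Q (i, l) * Q (j, l)))"
    by (simp add: P_def power2_eq_square sum_product)
  also have "\<dots> = (\<Sum>i<p. \<Sum>k<p. \<Sum>j<p. \<Sum>l<p. Q (i, k) * Q (j, k) * (Q (i, l) * Q (j, l)))"
    by (rule sum.cong[OF refl], rule sum.swap)
  also have "\<dots> = (\<Sum>k<p. \<Sum>i<p. \<Sum>j<p. \<Sum>l<p. Q (i, k) * Q (j, k) * (Q (i, l) * Q (j, l)))"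
    by (rule sum.swap)
  also have "\<dots> = (\<Sum>k<p. \<Sum>i<p. \<Sum>l<p. \<Sum>j<p. Q (i, k) * Q (j, k) * (Q (i, l) * Q (j, l)))"
    by (rule sum.cong[OF refl], rule sum.cong[OF refl], rule sum.swap)
  also have "\<dots> = (\<Sum>k<p. \<Sum>l<p. \<Sum>i<p. \<Sum>j<p. Q (i, k) * Q (j, k) * (Q (i, l) * Q (j, l)))"
    by (rule sum.cong[OF refl], rule sum.swap)
  also have "\<dots> = (\<Sum>k<p. \<Sum>l<p. (\<Sum>i<p. Q (i, k) * Q (i, l)) * (\<Sum>j<p. Q (j, k) * Q (j, l)))"
    by (simp add: sum_product mult_ac)
  also have "\<dots> = (\<Sum>k<p. \<Sum>l<p. d k l)"
    by (intro sum.cong refl) (simp add: col, simp add: d_def)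
  also have "\<dots> = p" by (simp add: d_def)
  finally have PP: "(\<Sum>i<p. \<Sum>j<p. (P i j)\<^sup>2) = p" .
  have "(\<Sum>i<p. P i i) = (\<Sum>k<p. \<Sum>i<p. Q (i, k) * Q (i, k))"
    unfolding P_def by (rule sum.swap)
  also have "\<dots> = p" by (simp add: col d_def)
  finally have tr: "(\<Sum>i<p. P i i) = p" .
  have dd: "(\<Sum>j<p. d i j * P i j) = P i i" "(\<Sum>j<p. (d i j)\<^sup>2) = 1" if "i < p" for i
    using that by (auto simp: d_def if_distrib if_distribR power2_eq_square cong: if_cong)
  have "(\<Sum>i<p. \<Sum>j<p. (d i j - P i j)\<^sup>2) = 
    (\<Sum>i<p. (\<Sum>j<p. (d i j)\<^sup>2) - 2 * (\<Sum>j<p. d i j * P i j) + (\<Sum>j<p. (P i j)\<^sup>2))"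
    by (simp add: power2_diff sum.distrib sum_subtractf sum_distrib_left mult_ac)
  also have "\<dots> = 0"
    by (simp add: dd sum.distrib sum_subtractf PP tr flip: sum_distrib_left)
  finally have "(d i j - P i j)\<^sup>2 = 0"
    using ij by (simp add: sum_nonneg_eq_0_iff sum_nonneg)
  then show ?thesis by (simp add: P_def d_def)
qed

lemma transpose_in_orthogonal_group:
  assumes "Q \<in> orthogonal_group p"
  shows "mat_transpose p Q \<in> orthogonal_group p"
  using orthogonal_group_rows[OF assms]
  by (auto simp: orthogonal_group_def mat_transpose_def cong: sum.cong_simp)

lemma haar_left_invariant:
  assumes "is_haar_orthogonal p H" "G \<in> orthogonal_group p"
    and [measurable]: "f \<in> borel_measurable (mat_space p p)"
  shows "(\<integral>\<^sup>+Q. f (sq_mat_mult p G Q) \<partial>H) = (\<integral>\<^sup>+Q. f Q \<partial>H)"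
proof -
  have [measurable_cong]: "sets H = sets (mat_space p p)"
    using assms by (simp add: is_haar_orthogonal_def)
  have "G \<in> space (mat_space p p)"
    using assms(2) by (auto simp: orthogonal_group_def space_PiM PiE_def)
  then have [measurable]: "sq_mat_mult p G \<in> H \<rightarrow>\<^sub>M mat_space p p"
    by measurable
  have "(\<integral>\<^sup>+Q. f (sq_mat_mult p G Q) \<partial>H) = (\<integral>\<^sup>+Q. f Q \<partial>distr H (mat_space p p) (sq_mat_mult p G))"
    by (subst nn_integral_distr) auto
  then show ?thesis using assms by (simp add: is_haar_orthogonal_def)
qed

text \<open>
  Both integrals equal the double integral of \<open>f (P\<^sup>T Q)\<close> over independent copies \<open>P\<close>, \<open>Q\<close>.
\<close>

lemma haar_transpose_invariant:
  assumes H: "is_haar_orthogonal p H"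
    and [measurable]: "f \<in> borel_measurable (mat_space p p)"
  shows "(\<integral>\<^sup>+Q. f (mat_transpose p Q) \<partial>H) = (\<integral>\<^sup>+Q. f Q \<partial>H)"
proof -
  interpret prob_space H using H by (simp add: is_haar_orthogonal_def)
  interpret HH: pair_sigma_finite H H ..
  have [measurable_cong]: "sets H = sets (mat_space p p)"
    using H by (simp add: is_haar_orthogonal_def)
  have AEo: "AE Q in H. Q \<in> orthogonal_group p"
    using H by (simp add: is_haar_orthogonal_def)
  \<comment> \<open>Left invariance applies to orthogonal factors, and \<open>H\<close> is
    concentrated on the group only up to a null set, hence the AE form.\<close>
  have inner: "AE P in H. (\<integral>\<^sup>+Q. g (sq_mat_mult p (mat_transpose p P) Q) \<partial>H) = (\<integral>\<^sup>+Q. g Q \<partial>H)"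
    if "g \<in> borel_measurable (mat_space p p)" for g :: "_ \<Rightarrow> ennreal"
    using AEo
  proof eventually_elim
    case (elim P)
    show ?case
      by (rule haar_left_invariant[OF H transpose_in_orthogonal_group[OF elim] that])
  qed
  have ext: "P \<in> extensional ({..<p} \<times> {..<p})" if "P \<in> space H" for P
    using that sets_eq_imp_space_eq[OF \<open>sets H = _\<close>] by (auto simp: space_PiM PiE_def)
  have "(\<integral>\<^sup>+Q. f Q \<partial>H) = (\<integral>\<^sup>+P. (\<integral>\<^sup>+Q. f (sq_mat_mult p (mat_transpose p P) Q) \<partial>H) \<partial>H)"
    by (subst nn_integral_cong_AE[OF inner]) (auto simp: emeasure_space_1)
  also have "\<dots> = (\<integral>\<^sup>+Q. (\<integral>\<^sup>+P. f (sq_mat_mult p (mat_transpose p P) Q) \<partial>H) \<partial>H)"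
    by (rule HH.Fubini') measurable
  \<comment> \<open>Here \<open>P^T Q = (Q^T P)^T\<close>, so \<open>inner\<close> applies again
    with the roles of \<open>P\<close> and \<open>Q\<close> exchanged and with \<open>f\<close>
    composed with transposition.\<close>
  also have "\<dots> = (\<integral>\<^sup>+Q. (\<integral>\<^sup>+P. f (mat_transpose p (sq_mat_mult p (mat_transpose p Q) P)) \<partial>H) \<partial>H)"
    by (intro nn_integral_cong) (simp add: transpose_sq_mat_mult transpose_transpose ext)
  also have "\<dots> = (\<integral>\<^sup>+P. f (mat_transpose p P) \<partial>H)"
    by (subst nn_integral_cong_AE[OF inner]) (auto simp: emeasure_space_1)
  finally show ?thesis by simp
qed

text \<open>Transposition turns right multiplication into left multiplication:
  \<open>Q^T G = (G^T Q)^T\<close>. Transpose invariance is used on entry and on exit, left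
  invariance in between.\<close>

lemma haar_right_invariant:
  assumes H: "is_haar_orthogonal p H" and G: "G \<in> orthogonal_group p"
    and f [measurable]: "f \<in> borel_measurable (mat_space p p)"
  shows "(\<integral>\<^sup>+Q. f (sq_mat_mult p Q G) \<partial>H) = (\<integral>\<^sup>+Q. f Q \<partial>H)"
proof -
  have Gs[measurable]: "G \<in> space (mat_space p p)"
    using G by (auto simp: orthogonal_group_def space_PiM PiE_def)
  have sq: "sq_mat_mult p A B \<in> extensional ({..<p} \<times> {..<p})" for A B
    by (auto simp: sq_mat_mult_def)
  have "(\<integral>\<^sup>+Q. f (sq_mat_mult p Q G) \<partial>H) = (\<integral>\<^sup>+Q. f (sq_mat_mult p (mat_transpose p Q) G) \<partial>H)"
    by (rule haar_transpose_invariant[OF H, symmetric]) measurable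
  also have "\<dots> = (\<integral>\<^sup>+Q. f (mat_transpose p (sq_mat_mult p (mat_transpose p G) Q)) \<partial>H)"
  proof (rule nn_integral_cong)
    fix Q assume "Q \<in> space H"
    have "mat_transpose p (mat_transpose p G) = G"
      using G by (intro transpose_transpose) (auto simp: orthogonal_group_def)
    then show "f (sq_mat_mult p (mat_transpose p Q) G) = f (mat_transpose p (sq_mat_mult p (mat_transpose p G) Q))"
      by (simp add: transpose_sq_mat_mult)
  qed
  also have "\<dots> = (\<integral>\<^sup>+Q. f (mat_transpose p Q) \<partial>H)"
    by (rule haar_left_invariant[OF H transpose_in_orthogonal_group[OF G]]) measurable
  also have "\<dots> = (\<integral>\<^sup>+Q. f Q \<partial>H)"
    by (rule haar_transpose_invariant[OF H f])
  finally show ?thesis .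
qed

text \<open>Each element of \<open>S\<close> is the centre of its own block, and the remaining
  \<open>p - r\<close> indices are dealt out to the centres in turn, modulo \<open>r\<close>.
  Keeping \<open>c s = s\<close> on \<open>S\<close> lets the reflections below act at the columns
  selected by \<open>\<eta>\<close>.\<close>

lemma ex_block_assignment:
  assumes S: "S \<subseteq> {..<p}" and r: "card S = r" "r > 0"
  obtains c :: "nat \<Rightarrow> nat" where "\<And>j. j < p \<Longrightarrow> c j \<in> S" "\<And>s. s \<in> S \<Longrightarrow> c s = s"
    "\<And>s. s \<in> S \<Longrightarrow> p div r \<le> card {j \<in> {..<p}. c j = s}"
proof -
  have fin: "finite S" using S finite_subset by blast
  obtain f where f: "bij_betw f {0..<r} S"
    using ex_bij_betw_nat_finite[OF fin] r by auto
  have "card ({..<p} - S) = p - r"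
    using S r fin by (simp add: card_Diff_subset)
  then obtain g where g: "bij_betw g {0..<p - r} ({..<p} - S)"
    using ex_bij_betw_nat_finite[of "{..<p} - S"] by auto
  define c where "c j = (if j \<in> S then j else f (inv_into {0..<p - r} g j mod r))" for j
  have cg: "c (g i) = f (i mod r)" if "i < p - r" for i
    using that g by (auto simp: c_def bij_betw_def inv_into_f_f)
  have fS: "f k \<in> S" if "k < r" for k
    using f that by (auto simp: bij_betw_def)
  have gS: "g k < p \<and> g k \<notin> S" if "k < p - r" for k
    using bij_betwE[OF g] that by auto
  have "p div r \<le> card {j \<in> {..<p}. c j = s}" if s: "s \<in> S" for s
  proof -
    obtain k where k: "k < r" "s = f k"
      using s f by (auto simp: bij_betw_def)
    \<comment> \<open>An injective list of \<open>p div r\<close> members of the block: the centre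
      itself, then the indices dealt to it.\<close>
    define h where "h t = (case t of 0 \<Rightarrow> s | Suc t' \<Rightarrow> g (t' * r + k))" for t
    \<comment> \<open>The centre takes place \<open>0\<close> of the list, so \<open>t\<close> runs
      only up to \<open>p div r - 2\<close>; then \<open>(t + 2) * r \<le> p\<close>, which leaves
      room for both \<open>k < r\<close> and the \<open>r\<close> centres.\<close>
    have bd: "t * r + k < p - r" if "Suc t < p div r" for t
    proof -
      have "Suc (Suc t) * r \<le> p div r * r" using that by (intro mult_right_mono) auto
      also have "\<dots> \<le> p" by simp
      finally show ?thesis using k by simp
    qed
    have "inj_on h {..<p div r}"
    proof (rule inj_onI)
      fix x y assume xy: "x \<in> {..<p div r}" "y \<in> {..<p div r}" "h x = h y"
      have g_inj: "g a = g b \<Longrightarrow> a < p - r \<Longrightarrow> b < p - r \<Longrightarrow> a = b" for a b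
        using g by (auto simp: bij_betw_def inj_on_def)
      have gi: "a = b" if "g (a * r + k) = g (b * r + k)" "Suc a < p div r" "Suc b < p div r" for a b
      proof -
        have "a * r + k = b * r + k"
          by (rule g_inj[OF that(1) bd[OF that(2)] bd[OF that(3)]])
        then show ?thesis using r(2) by simp
      qed
      have gs: "g (a * r + k) \<noteq> s" if "Suc a < p div r" for a
        using gS[OF bd[OF that]] s by blast
      show "x = y"
        using xy gi gs by (cases x; cases y) (auto simp: h_def)
    qed
    moreover have "h ` {..<p div r} \<subseteq> {j \<in> {..<p}. c j = s}"
      using S s k bd gS by (auto simp: h_def cg split: nat.splits) (auto simp: c_def)
    ultimately show ?thesis
      using card_inj_on_le[of h "{..<p div r}" "{j \<in> {..<p}. c j = s}"] by simp
  qed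
  moreover have "c s = s" if "s \<in> S" for s using that by (simp add: c_def)
  moreover have "c j \<in> S" if "j < p" for j
    using fS r(2) by (auto simp: c_def)
  ultimately show ?thesis using that by blast
qed

definition bool_sign :: "bool \<Rightarrow> real" where
  "bool_sign b = (if b then 1 else - 1)"

lemma bool_sign_mult [simp]: "bool_sign b * bool_sign b = 1"
  by (simp add: bool_sign_def)

lemma bool_sign_power2 [simp]: "(bool_sign b)\<^sup>2 = 1"
  by (simp add: bool_sign_def)

text \<open>
  The witness is a product of commuting Householder reflections, one per fibre of \<open>c\<close>, each
  exchanging the unit vector at the centre \<open>s\<close> of the fibre with the normalised indicator of the
  fibre, followed by coordinate sign changes. On a singleton fibre \<open>v\<close> vanishes, so the junk
  value of \<open>\<kappa>\<close> is harmless.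
\<close>

lemma ex_block_sign_orthogonal:
  fixes p :: nat and c :: "nat \<Rightarrow> nat"
  assumes S: "S \<subseteq> {..<p}" and c: "\<And>j. j < p \<Longrightarrow> c j \<in> S" "\<And>s. s \<in> S \<Longrightarrow> c s = s"
  obtains G :: "(nat \<Rightarrow> bool) \<Rightarrow> (nat \<times> nat \<Rightarrow> real)" where
    "\<And>\<epsilon>. G \<epsilon> \<in> orthogonal_group p"
    "\<And>\<epsilon> s j. s \<in> S \<Longrightarrow> j < p \<Longrightarrow> G \<epsilon> (j, s) =
      (if c j = s then bool_sign (\<epsilon> j) / sqrt (card {i \<in> {..<p}. c i = s}) else 0)"
proof -
  define m where "m s = real (card {i \<in> {..<p}. c i = s})" for s
  \<comment> \<open>On the fibre of \<open>s\<close>, \<open>v\<close> is the normalised indicator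
    minus the unit vector at \<open>s\<close>. Its squared length is
    \<open>2 * (1 - 1 / sqrt (m s))\<close>, so for larger fibres \<open>\<kappa> s\<close> is the
    Householder factor \<open>2 / |v|^2\<close>, and \<open>I - W\<close> reflects every fibre at
    once.\<close>
  define v where "v i = 1 / sqrt (m (c i)) - (if i \<in> S then 1 else 0)" for i
  define \<kappa> where "\<kappa> s = 1 / (1 - 1 / sqrt (m s))" for s
  define W where "W i j = (if c i = c j then \<kappa> (c i) * v i * v j else 0)" for i j
  define d where "d i j = (if i = j then 1 else 0 :: real)" for i j :: nat
  define G where "G \<epsilon> = (\<lambda>(i, j) \<in> {..<p} \<times> {..<p}. bool_sign (\<epsilon> i) * (d i j - W i j))" for \<epsilon> :: "nat \<Rightarrow> bool"
  have m1: "m s \<ge> 1" if "s \<in> S" for s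
  proof -
    have "card {s} \<le> card {i \<in> {..<p}. c i = s}"
      using that S c by (intro card_mono) auto
    then show ?thesis by (simp add: m_def)
  qed
  have vv: "(\<Sum>k<p. if c k = s then (v k)\<^sup>2 else 0) = 2 * (1 - 1 / sqrt (m s))" if s: "s \<in> S" for s
  proof -
    have "(\<Sum>k<p. if c k = s then (v k)\<^sup>2 else 0) = (\<Sum>k\<in>{i \<in> {..<p}. c i = s}. (v k)\<^sup>2)"
      by (rule sum.inter_filter[symmetric]) simp
    also have "\<dots> = (\<Sum>k\<in>{i \<in> {..<p}. c i = s}. 1 / m s + (if k = s then 1 - 2 / sqrt (m s) else 0))"
    proof (intro sum.cong refl)
      fix k assume k: "k \<in> {i \<in> {..<p}. c i = s}"
      then have "k \<in> S \<longleftrightarrow> k = s" using c s by auto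
      then show "(v k)\<^sup>2 = 1 / m s + (if k = s then 1 - 2 / sqrt (m s) else 0)"
        using k m1[OF s] by (auto simp: v_def power2_diff power_divide)
    qed
    also have "\<dots> = m s * (1 / m s) + (1 - 2 / sqrt (m s))"
      using s S c by (auto simp: sum.distrib m_def)
    finally show ?thesis using m1[OF s] by simp
  qed
  have \<kappa>2: "\<kappa> s * \<kappa> s * (2 * (1 - 1 / sqrt (m s))) = 2 * \<kappa> s" for s
  proof (cases "1 - 1 / sqrt (m s) = 0")
    case False
    define x where "x = 1 - 1 / sqrt (m s)"
    show ?thesis
      using False unfolding \<kappa>_def x_def[symmetric] by simp
  qed (simp add: \<kappa>_def)
  \<comment> \<open>As \<open>W\<close> is symmetric, \<open>W W = 2 W\<close> says
    \<open>(I - W)^2 = I\<close>. Distinct fibres do not interact, since \<open>W\<close> vanishes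
    between them.\<close>
  have WW: "(\<Sum>k<p. W k i * W k j) = 2 * W i j" if ij: "i < p" "j < p" for i j
  proof (cases "c i = c j")
    case True
    have "(\<Sum>k<p. W k i * W k j) = (\<Sum>k<p. \<kappa> (c i) * \<kappa> (c i) * v i * v j * (if c k = c i then (v k)\<^sup>2 else 0))"
      using True by (intro sum.cong) (auto simp: W_def power2_eq_square)
    also have "\<dots> = \<kappa> (c i) * \<kappa> (c i) * v i * v j * (2 * (1 - 1 / sqrt (m (c i))))"
      using vv[of "c i"] c ij by (simp flip: sum_distrib_left)
    also have "\<dots> = \<kappa> (c i) * \<kappa> (c i) * (2 * (1 - 1 / sqrt (m (c i)))) * v i * v j"
      by (simp only: mult_ac)
    also have "\<dots> = 2 * W i j"
      unfolding \<kappa>2 using True by (simp add: W_def)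
    finally show ?thesis .
  next
    case False
    then have "(\<Sum>k<p. W k i * W k j) = 0" by (intro sum.neutral) (auto simp: W_def)
    then show ?thesis using False by (simp add: W_def)
  qed
  have dsum: "(\<Sum>k<p. d k i * f k) = f i" if "i < p" for i f
  proof -
    have "d k i * f k = (if k = i then f k else 0)" for k by (simp add: d_def)
    then show ?thesis using that by simp
  qed
  have Wsym: "W i j = W j i" for i j by (simp add: W_def)
  have "G \<epsilon> \<in> orthogonal_group p" for \<epsilon>
  proof -
    have "(\<Sum>k<p. G \<epsilon> (k, i) * G \<epsilon> (k, j)) = d i j" if ij: "i < p" "j < p" for i j
    proof -
      have "(\<Sum>k<p. G \<epsilon> (k, i) * G \<epsilon> (k, j)) = (\<Sum>k<p. (d k i - W k i) * (d k j - W k j))"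
      proof (intro sum.cong refl)
        fix k assume "k \<in> {..<p}"
        then have "G \<epsilon> (k, i) * G \<epsilon> (k, j) =
          (bool_sign (\<epsilon> k) * bool_sign (\<epsilon> k)) * ((d k i - W k i) * (d k j - W k j))"
          using ij by (simp add: G_def mult_ac del: bool_sign_mult)
        then show "G \<epsilon> (k, i) * G \<epsilon> (k, j) = (d k i - W k i) * (d k j - W k j)" by simp
      qed
      also have "\<dots> = (\<Sum>k<p. d k i * d k j) - (\<Sum>k<p. d k i * W k j) - (\<Sum>k<p. d k j * W k i) + (\<Sum>k<p. W k i * W k j)"
        by (simp add: algebra_simps sum.distrib sum_subtractf)
      also have "\<dots> = d i j - W i j - W j i + 2 * W i j"
        using ij by (simp add: WW dsum)
      finally show ?thesis by (simp add: Wsym)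
    qed
    then show ?thesis
      by (auto simp: orthogonal_group_def G_def[of \<epsilon>] d_def)
  qed
  moreover have "G \<epsilon> (j, s) = (if c j = s then bool_sign (\<epsilon> j) / sqrt (card {i \<in> {..<p}. c i = s}) else 0)"
    if s: "s \<in> S" and j: "j < p" for \<epsilon> s j
  proof -
    \<comment> \<open>At a centre \<open>v s = -(1 - 1 / sqrt (m s))\<close>, so
      \<open>\<kappa> s * v s = -1\<close> and the column at \<open>s\<close> is the unit vector
      plus \<open>v\<close>, which is the normalised indicator of the fibre.\<close>
    have "d j s - W j s = (if c j = s then 1 / sqrt (m s) else 0)"
    proof (cases "c j = s")
      case True
      have jS: "j \<in> S \<longleftrightarrow> j = s" using True c s by auto
      show ?thesis
      proof (cases "m s = 1")
        case ms: True
        then have "card {i \<in> {..<p}. c i = s} = 1" by (simp add: m_def)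
        then obtain x where "{i \<in> {..<p}. c i = s} = {x}" by (auto simp: card_1_singleton_iff)
        moreover have "s \<in> {i \<in> {..<p}. c i = s}" "j \<in> {i \<in> {..<p}. c i = s}"
          using s S c j True by auto
        ultimately have "j = s" by auto
        then show ?thesis using c s True ms by (simp add: W_def v_def d_def)
      next
        case False
        then have "m s > 1" using m1[OF s] by simp
        then have *: "1 - 1 / sqrt (m s) \<noteq> 0" by (simp add: field_simps)
        have "W j s = \<kappa> s * v s * v j" using True c s by (simp add: W_def mult_ac)
        moreover have "v s = - (1 - 1 / sqrt (m s))" using c s by (simp add: v_def)
        ultimately have "W j s = \<kappa> s * (- (1 - 1 / sqrt (m s))) * v j" by simp
        moreover have "\<kappa> s * (- (1 - 1 / sqrt (m s))) = - 1"
          using * unfolding \<kappa>_def by (simp only: mult_minus_right) simp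
        ultimately have "W j s = - v j" by simp
        then show ?thesis using True jS by (simp add: v_def d_def)
      qed
    next
      case False
      then show ?thesis using c s by (auto simp: W_def d_def)
    qed
    then show ?thesis using s S j by (auto simp: G_def m_def)
  qed
  ultimately show ?thesis using that by blast
qed

subsection \<open>Gaussian mixtures\<close>

text \<open>This is \<open>f (L - 1) \<le> |L - 1| \<le> c / 2 + (L - 1)^2 / (2 c)\<close>, with the
  square expanded and every negative term moved to the other side, because \<open>ennreal\<close>
  has no true subtraction. The parameter \<open>c\<close> replaces the Cauchy-Schwarz inequality and
  is chosen after integration.\<close>

lemma pointwise_likelihood_bound:
  fixes f c :: real and L :: ennreal
  assumes f: "0 \<le> f" "f \<le> 1" and c: "c > 0"
  shows "ennreal f * L + ennreal (1 / c) * L \<le>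
    ennreal f + ennreal (c / 2 + 1 / (2 * c)) + ennreal (1 / (2 * c)) * (L * L)"
proof (cases L)
  case (real l)
  have "f * (l - 1) \<le> \<bar>l - 1\<bar>"
  proof -
    have "f * (l - 1) \<le> f * \<bar>l - 1\<bar>" using f by (intro mult_left_mono) auto
    also have "\<dots> \<le> 1 * \<bar>l - 1\<bar>" using f by (intro mult_right_mono) auto
    finally show ?thesis by simp
  qed
  also have "\<bar>l - 1\<bar> \<le> c / 2 + (l - 1)\<^sup>2 / (2 * c)"
  proof -
    have "0 \<le> (c - \<bar>l - 1\<bar>)\<^sup>2" by simp
    then have "2 * c * \<bar>l - 1\<bar> \<le> c\<^sup>2 + (l - 1)\<^sup>2"
      by (simp add: power2_diff[of c])
    then have "\<bar>l - 1\<bar> \<le> (c\<^sup>2 + (l - 1)\<^sup>2) / (2 * c)"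
      using c by (simp add: pos_le_divide_eq mult.commute)
    then show ?thesis using c by (simp add: add_divide_distrib power2_eq_square)
  qed
  finally have "f * l + 1 / c * l \<le> f + (c / 2 + 1 / (2 * c)) + 1 / (2 * c) * (l * l)"
  proof -
    have "(l - 1)\<^sup>2 / (2 * c) = 1 / (2 * c) * (l * l) - 1 / c * l + 1 / (2 * c)"
      using c by (simp add: power2_eq_square field_simps)
    moreover assume "f * (l - 1) \<le> c / 2 + (l - 1)\<^sup>2 / (2 * c)"
    ultimately show ?thesis by (simp add: right_diff_distrib)
  qed
  then show ?thesis
    using f c real by (simp flip: ennreal_plus ennreal_mult add: ennreal_leI)
next
  case top
  then show ?thesis using c by (simp add: ennreal_mult_top ennreal_top_mult)
qed

text \<open>The second moment method. For a random translate of white noise the likelihood ratio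
  \<open>L\<close> averages the Cameron-Martin densities, and its second moment is the mean of
  \<open>exp\<close> of the inner product of two independent shifts. So \<open>\<xi>\<close> bounds
  the chi-square divergence, and no test gains more than its square root.\<close>

lemma gauss_mixture_bound:
  fixes \<mu> :: "'w \<Rightarrow> 'i \<Rightarrow> real" and f :: "('i \<Rightarrow> real) \<Rightarrow> real"
  assumes I: "finite I" and W: "prob_space W"
    and \<mu>: "\<And>i. i \<in> I \<Longrightarrow> (\<lambda>w. \<mu> w i) \<in> borel_measurable W"
    and \<xi>: "(\<integral>\<^sup>+w. \<integral>\<^sup>+w'. ennreal (exp (\<Sum>i\<in>I. \<mu> w i * \<mu> w' i)) \<partial>W \<partial>W) \<le> ennreal (1 + \<xi>)" "\<xi> > 0"
    and f [measurable]: "f \<in> borel_measurable (PiM I (\<lambda>_. borel))"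
    and f01: "\<And>x. x \<in> space (PiM I (\<lambda>_. borel)) \<Longrightarrow> 0 \<le> f x \<and> f x \<le> 1"
  shows "(\<integral>\<^sup>+w. \<integral>\<^sup>+x. ennreal (f (\<lambda>i\<in>I. x i + \<mu> w i)) \<partial>gauss I \<partial>W) \<le>
    (\<integral>\<^sup>+x. ennreal (f x) \<partial>gauss I) + ennreal (sqrt \<xi>)"
proof -
  interpret W: prob_space W by fact
  interpret Wg: pair_sigma_finite W "gauss I" ..
  interpret WW: pair_sigma_finite W W ..
  have spg: "space (gauss I) = space (PiM I (\<lambda>_. borel))" by (simp add: space_PiM)
  define e where "e w x = ennreal (exp (\<Sum>i\<in>I. \<mu> w i * x i - (\<mu> w i)\<^sup>2 / 2))" for w x
  define L where "L x = (\<integral>\<^sup>+w. e w x \<partial>W)" for x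
  have m1 [measurable]: "(\<lambda>z. \<mu> (fst z) i) \<in> borel_measurable (W \<Otimes>\<^sub>M N)" if "i \<in> I" for i and N :: "'z measure"
    by (rule measurable_compose[OF measurable_fst \<mu>[OF that]])
  have e_meas [measurable]: "(\<lambda>(w, x). e w x) \<in> borel_measurable (W \<Otimes>\<^sub>M gauss I)"
    unfolding e_def case_prod_beta by measurable
  have e_meas' [measurable]: "(\<lambda>w. e w x) \<in> borel_measurable W" for x
    unfolding e_def using \<mu> by measurable
  have e_meas'' [measurable]: "e w \<in> borel_measurable (gauss I)" for w
    unfolding e_def by measurable
  have swap: "(\<integral>\<^sup>+w. \<integral>\<^sup>+x. h x * e w x \<partial>gauss I \<partial>W) = (\<integral>\<^sup>+x. h x * L x \<partial>gauss I)"
    if [measurable]: "h \<in> borel_measurable (gauss I)" for h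
  proof -
    have "(\<integral>\<^sup>+w. \<integral>\<^sup>+x. h x * e w x \<partial>gauss I \<partial>W) = (\<integral>\<^sup>+x. \<integral>\<^sup>+w. h x * e w x \<partial>W \<partial>gauss I)"
      by (rule Wg.Fubini'[symmetric]) measurable
    also have "\<dots> = (\<integral>\<^sup>+x. h x * L x \<partial>gauss I)"
      unfolding L_def by (intro nn_integral_cong nn_integral_cmult) auto
    finally show ?thesis .
  qed
  have L_meas [measurable]: "L \<in> borel_measurable (gauss I)"
    unfolding L_def by measurable
  have shift: "(\<integral>\<^sup>+x. ennreal (f (\<lambda>i\<in>I. x i + \<mu> w i)) \<partial>gauss I) = (\<integral>\<^sup>+x. ennreal (f x) * e w x \<partial>gauss I)" for w
    unfolding e_def by (rule gauss_shift[OF I]) auto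
  have e1: "(\<integral>\<^sup>+x. e w x \<partial>gauss I) = 1" for w
    using gauss_shift[OF I, of "\<lambda>_. 1" "\<mu> w"] by (simp add: e_def gauss.emeasure_space_1)
  have L1: "(\<integral>\<^sup>+x. L x \<partial>gauss I) = 1"
    using swap[of "\<lambda>_. 1"] by (simp add: e1 W.emeasure_space_1)
  have ee: "(\<integral>\<^sup>+x. e w x * e w' x \<partial>gauss I) = ennreal (exp (\<Sum>i\<in>I. \<mu> w i * \<mu> w' i))" for w w'
  proof -
    have "e w x * e w' x = ennreal (exp (- (\<Sum>i\<in>I. (\<mu> w i)\<^sup>2 / 2 + (\<mu> w' i)\<^sup>2 / 2))) *
      ennreal (exp (\<Sum>i\<in>I. (\<mu> w i + \<mu> w' i) * x i))" for x
      by (simp add: e_def exp_add[symmetric] ennreal_mult[symmetric] algebra_simps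
          sum.distrib sum_subtractf)
    then have "(\<integral>\<^sup>+x. e w x * e w' x \<partial>gauss I) =
      ennreal (exp (- (\<Sum>i\<in>I. (\<mu> w i)\<^sup>2 / 2 + (\<mu> w' i)\<^sup>2 / 2))) *
      ennreal (exp ((\<Sum>i\<in>I. (\<mu> w i + \<mu> w' i)\<^sup>2) / 2))"
      by (simp add: nn_integral_cmult gauss_exp_linear[OF I])
    also have "\<dots> = ennreal (exp (\<Sum>i\<in>I. \<mu> w i * \<mu> w' i))"
      by (simp add: exp_add[symmetric] ennreal_mult[symmetric] power2_sum add_divide_distrib
          sum.distrib sum_divide_distrib)
    finally show ?thesis .
  qed
  have "(\<integral>\<^sup>+x. L x * L x \<partial>gauss I) = (\<integral>\<^sup>+w. \<integral>\<^sup>+x. L x * e w x \<partial>gauss I \<partial>W)"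
    by (rule swap[symmetric]) simp
  also have "\<dots> = (\<integral>\<^sup>+w. \<integral>\<^sup>+x. e w x * L x \<partial>gauss I \<partial>W)"
    by (simp add: mult.commute)
  also have "\<dots> = (\<integral>\<^sup>+w. \<integral>\<^sup>+w'. \<integral>\<^sup>+x. e w x * e w' x \<partial>gauss I \<partial>W \<partial>W)"
    by (simp add: swap)
  also have "\<dots> \<le> ennreal (1 + \<xi>)"
    unfolding ee by (rule \<xi>)
  finally have L2: "(\<integral>\<^sup>+x. L x * L x \<partial>gauss I) \<le> ennreal (1 + \<xi>)" .
  \<comment> \<open>This choice minimises \<open>c / 2 + \<xi> / (2 c)\<close>, with minimum
    \<open>sqrt \<xi>\<close>; positivity of \<open>\<xi>\<close> makes it admissible as a
    divisor.\<close>
  define c where "c = sqrt \<xi>"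
  have c: "c > 0" "c * c = \<xi>" using \<xi>(2) by (auto simp: c_def)
  define A where "A = (\<integral>\<^sup>+w. \<integral>\<^sup>+x. ennreal (f (\<lambda>i\<in>I. x i + \<mu> w i)) \<partial>gauss I \<partial>W)"
  define B where "B = (\<integral>\<^sup>+x. ennreal (f x) \<partial>gauss I)"
  have A: "A = (\<integral>\<^sup>+x. ennreal (f x) * L x \<partial>gauss I)"
    unfolding A_def shift by (rule swap) auto
  have "A + ennreal (1 / c) = (\<integral>\<^sup>+x. ennreal (f x) * L x + ennreal (1 / c) * L x \<partial>gauss I)"
    by (simp add: A nn_integral_add nn_integral_cmult L1)
  also have "\<dots> \<le> (\<integral>\<^sup>+x. ennreal (f x) + ennreal (c / 2 + 1 / (2 * c)) + ennreal (1 / (2 * c)) * (L x * L x) \<partial>gauss I)"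
    using f01 c by (intro nn_integral_mono pointwise_likelihood_bound) (auto simp: spg)
  also have "\<dots> = B + ennreal (c / 2 + 1 / (2 * c)) + ennreal (1 / (2 * c)) * (\<integral>\<^sup>+x. L x * L x \<partial>gauss I)"
    by (simp add: nn_integral_add nn_integral_cmult B_def gauss.emeasure_space_1)
  also have "\<dots> \<le> B + ennreal (c / 2 + 1 / (2 * c)) + ennreal (1 / (2 * c)) * ennreal (1 + \<xi>)"
    by (intro add_left_mono mult_left_mono L2) auto
  also have "\<dots> = B + ennreal c + ennreal (1 / c)"
  proof -
    have "c / 2 + 1 / (2 * c) + 1 / (2 * c) * (1 + \<xi>) = c + 1 / c"
      using c by (simp add: c(2)[symmetric] field_simps)
    then show ?thesis
      using c \<xi>(2) by (simp add: add.assoc flip: ennreal_plus ennreal_mult)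
  qed
  finally have "ennreal (1 / c) + A \<le> ennreal (1 / c) + (B + ennreal c)"
    by (simp add: add_ac)
  then have "A \<le> B + ennreal c"
    by (simp only: ennreal_add_left_cancel_le) simp
  then show ?thesis by (simp add: A_def B_def c_def)
qed

subsection \<open>The second moment\<close>

abbreviation coins :: "nat \<Rightarrow> (nat \<Rightarrow> bool) measure" where
  "coins p \<equiv> PiM {..<p} (\<lambda>_. measure_pmf (bernoulli_pmf (1 / 2)))"

interpretation coins: product_prob_space "\<lambda>_::nat. measure_pmf (bernoulli_pmf (1 / 2))" I for I
  by unfold_locales

text \<open>The analytic core of Hoeffding's lemma for a symmetric sign: an interval of length
  \<open>2 t\<close> with success probability \<open>1 / 2\<close> gives the exponent
  \<open>(2 t)^2 / 8\<close>. Negative \<open>t\<close> follows by symmetry.\<close>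

lemma cosh_le_exp_square: "(exp t + exp (- t)) / 2 \<le> exp (t\<^sup>2 / 2)" for t :: real
proof -
  have *: "(exp t + exp (- t)) / 2 \<le> exp (t\<^sup>2 / 2)" if "t \<ge> 0" for t :: real
  proof -
    have "exp (- t + ln ((1 + exp (2 * t)) / 2)) \<le> exp (t\<^sup>2 / 2)"
      using Hoeffdings_lemma_aux[of "2 * t" "1 / 2"] that
      by (simp add: power_mult_distrib field_simps)
    moreover have "exp (- t + ln ((1 + exp (2 * t)) / 2)) = exp (- t) * ((1 + exp (2 * t)) / 2)"
      unfolding exp_add by (subst exp_ln) (auto intro: add_pos_pos)
    moreover have "exp (- t) * ((1 + exp (2 * t)) / 2) = (exp t + exp (- t)) / 2"
      by (simp add: field_simps flip: exp_add)
    ultimately show ?thesis by linarith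
  qed
  show ?thesis using *[of t] *[of "- t"] by (cases "t \<ge> 0") (auto simp: add.commute)
qed

lemma coin_exp_le:
  "(\<integral>\<^sup>+b. ennreal (exp (t * bool_sign b)) \<partial>measure_pmf (bernoulli_pmf (1 / 2))) \<le> ennreal (exp (t\<^sup>2 / 2))"
proof -
  have "(\<integral>\<^sup>+b. ennreal (exp (t * bool_sign b)) \<partial>measure_pmf (bernoulli_pmf (1 / 2))) =
    ennreal ((exp t + exp (- t)) / 2)"
  proof -
    have "(\<integral>\<^sup>+b. ennreal (exp (t * bool_sign b)) \<partial>measure_pmf (bernoulli_pmf (1 / 2))) =
      ennreal (exp t) * ennreal (1 / 2) + ennreal (exp (- t)) * ennreal (1 - 1 / 2)"
      by (subst nn_integral_bernoulli_pmf) (auto simp: bool_sign_def)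
    also have "\<dots> = ennreal (exp t * (1 / 2) + exp (- t) * (1 - 1 / 2))"
      by (subst ennreal_plus, simp, simp) (simp only: ennreal_mult' exp_ge_zero)
    finally show ?thesis by (simp add: field_simps)
  qed
  then show ?thesis using cosh_le_exp_square[of t] by (simp add: ennreal_leI)
qed

lemma coins_exp_linear_le:
  "(\<integral>\<^sup>+\<epsilon>. ennreal (exp (\<Sum>l<p. t l * bool_sign (\<epsilon> l))) \<partial>coins p) \<le> ennreal (exp ((\<Sum>l<p. (t l)\<^sup>2) / 2))"
proof -
  have "(\<integral>\<^sup>+\<epsilon>. ennreal (exp (\<Sum>l<p. t l * bool_sign (\<epsilon> l))) \<partial>coins p) =
    (\<integral>\<^sup>+\<epsilon>. (\<Prod>l<p. ennreal (exp (t l * bool_sign (\<epsilon> l)))) \<partial>coins p)"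
    by (simp add: exp_sum prod_ennreal)
  also have "\<dots> = (\<Prod>l<p. \<integral>\<^sup>+b. ennreal (exp (t l * bool_sign b)) \<partial>measure_pmf (bernoulli_pmf (1 / 2)))"
    by (intro coins.product_nn_integral_prod) auto
  also have "\<dots> \<le> (\<Prod>l<p. ennreal (exp ((t l)\<^sup>2 / 2)))"
    by (intro prod_mono_ennreal coin_exp_le)
  also have "\<dots> = ennreal (exp ((\<Sum>l<p. (t l)\<^sup>2) / 2))"
    by (simp add: prod_ennreal exp_sum sum_divide_distrib)
  finally show ?thesis .
qed

lemma inverse_sqrt_le_exp:
  fixes x :: real
  assumes "0 \<le> x" "x \<le> 1 / 2"
  shows "1 / sqrt (1 - x) \<le> exp x"
proof -
  have "1 / (1 - x) \<le> 1 + 2 * x"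
  proof -
    have "0 \<le> x * (1 - 2 * x)" using assms by (intro mult_nonneg_nonneg) auto
    then have "1 \<le> (1 + 2 * x) * (1 - x)" by (simp add: algebra_simps)
    then show ?thesis using assms by (simp add: pos_divide_le_eq)
  qed
  also have "\<dots> \<le> exp (2 * x)" by (rule exp_ge_add_one_self)
  finally have "1 / (1 - x) \<le> (exp x)\<^sup>2" by (simp add: exp_double)
  then have "sqrt (1 / (1 - x)) \<le> exp x" by (intro real_le_lsqrt) auto
  then show ?thesis by (simp add: real_sqrt_divide)
qed

text \<open>The exact value is the product of \<open>1 / sqrt (1 - t i)\<close>. The cap
  \<open>1 / 2\<close> stays away from the pole at \<open>1\<close>, and it is the origin of the
  conditions \<open>a^2 \<le> 1 / 2\<close> and \<open>2 * (n * a^2) / m \<le> 1 / 2\<close> further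
  down.\<close>

lemma gauss_exp_square_le:
  assumes "finite I" "\<And>i. i \<in> I \<Longrightarrow> 0 \<le> t i \<and> t i \<le> 1 / 2"
  shows "(\<integral>\<^sup>+x. ennreal (exp (\<Sum>i\<in>I. t i * (x i)\<^sup>2 / 2)) \<partial>gauss I) \<le> ennreal (exp (\<Sum>i\<in>I. t i))"
proof -
  have "(\<integral>\<^sup>+x. ennreal (exp (\<Sum>i\<in>I. 0 * x i - (- t i) * (x i)\<^sup>2 / 2)) \<partial>gauss I) =
    ennreal (\<Prod>i\<in>I. exp (0\<^sup>2 / (2 * (1 + - t i))) / sqrt (1 + - t i))"
    using assms by (intro gauss_exp_quadratic) force+
  also have "\<dots> \<le> ennreal (\<Prod>i\<in>I. exp (t i))"
    using assms inverse_sqrt_le_exp by (intro ennreal_leI prod_mono) fastforce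
  finally show ?thesis using assms by (simp add: exp_sum)
qed

text \<open>The matrix argument need not be orthogonal and only its columns in \<open>S\<close>
  matter. It can therefore be a product with a frame whose other columns are zero.\<close>

definition signal :: "real \<Rightarrow> nat set \<Rightarrow> (nat \<times> nat \<Rightarrow> real) \<Rightarrow> (nat \<times> nat \<Rightarrow> real) \<Rightarrow> nat \<times> nat \<Rightarrow> real" where
  "signal a S Q z = (\<lambda>(i, j). sqrt a * (\<Sum>k\<in>S. z (i, k) * Q (j, k)))"

lemma measurable_signal [measurable (raw)]:
  assumes [measurable]: "f \<in> N \<rightarrow>\<^sub>M mat_space p p" "g \<in> N \<rightarrow>\<^sub>M mat_space n p"
    and S: "S \<subseteq> {..<p}" and ij: "ij \<in> {..<n} \<times> {..<p}"
  shows "(\<lambda>x. signal a S (f x) (g x) ij) \<in> borel_measurable N"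
proof -
  obtain i j where ij': "ij = (i, j)" "i < n" "j < p" using ij by auto
  have "(\<lambda>x. f x (j, k)) \<in> borel_measurable N" "(\<lambda>x. g x (i, k)) \<in> borel_measurable N" if "k \<in> S" for k
    using ij' S that
    by (auto intro!: measurable_compose[OF assms(1) measurable_component_singleton]
      measurable_compose[OF assms(2) measurable_component_singleton])
  then show ?thesis
    unfolding signal_def ij' by (auto intro!: borel_measurable_times borel_measurable_sum)
qed

text \<open>Multiplication by \<open>Q\<close> is an isometry; this is how the revealed
  \<open>Q\<close> disappears from the second moment.\<close>

lemma orthogonal_group_inner:
  assumes "Q \<in> orthogonal_group p"
  shows "(\<Sum>j<p. (\<Sum>l<p. Q (j, l) * x l) * (\<Sum>l<p. Q (j, l) * y l)) = (\<Sum>l<p. x l * y l)"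
proof -
  have "(\<Sum>j<p. (\<Sum>l<p. Q (j, l) * x l) * (\<Sum>l<p. Q (j, l) * y l)) =
    (\<Sum>j<p. \<Sum>l<p. \<Sum>l'<p. x l * y l' * (Q (j, l) * Q (j, l')))"
    by (simp add: sum_product mult_ac)
  also have "\<dots> = (\<Sum>l<p. \<Sum>j<p. \<Sum>l'<p. x l * y l' * (Q (j, l) * Q (j, l')))"
    by (rule sum.swap)
  also have "\<dots> = (\<Sum>l<p. \<Sum>l'<p. \<Sum>j<p. x l * y l' * (Q (j, l) * Q (j, l')))"
    by (rule sum.cong[OF refl], rule sum.swap)
  also have "\<dots> = (\<Sum>l<p. \<Sum>l'<p. if l' = l then x l * y l' else 0)"
    using assms by (intro sum.cong refl) (simp add: orthogonal_group_def flip: sum_distrib_left)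
  also have "\<dots> = (\<Sum>l<p. x l * y l)" by simp
  finally show ?thesis .
qed

text \<open>The map \<open>c\<close> is a retraction onto \<open>S\<close> and its fibres are the
  blocks. The real \<open>m\<close> is a common lower bound for the block sizes, so that estimates
  need not track individual blocks.\<close>

locale block_partition =
  fixes p :: nat and S :: "nat set" and c :: "nat \<Rightarrow> nat" and m :: real
  assumes S: "S \<subseteq> {..<p}"
    and c_in: "\<And>j. j < p \<Longrightarrow> c j \<in> S"
    and c_id: "\<And>s. s \<in> S \<Longrightarrow> c s = s"
    and m: "m > 0" "\<And>s. s \<in> S \<Longrightarrow> m \<le> real (card {j \<in> {..<p}. c j = s})"
begin

definition block_size :: "nat \<Rightarrow> real" where
  "block_size s = real (card {j \<in> {..<p}. c j = s})"

text \<open>In the columns in \<open>S\<close> this is the orthogonal witness built above; all other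
  columns vanish because \<open>c\<close> takes values in \<open>S\<close>. Being explicit, it is
  measurable in the signs, which a witness known only to exist need not be.\<close>

definition sign_frame :: "(nat \<Rightarrow> bool) \<Rightarrow> nat \<times> nat \<Rightarrow> real" where
  "sign_frame \<epsilon> = (\<lambda>(l, k) \<in> {..<p} \<times> {..<p}. if c l = k then bool_sign (\<epsilon> l) / sqrt (block_size k) else 0)"

text \<open>The \<open>k\<close>-th diagonal entry of the Gram matrix between two sign frames, that
  is, the average of the products of signs over block \<open>k\<close>. Off-diagonal entries vanish,
  as distinct columns have disjoint supports.\<close>

definition overlap :: "(nat \<Rightarrow> bool) \<Rightarrow> (nat \<Rightarrow> bool) \<Rightarrow> nat \<Rightarrow> real" where
  "overlap \<epsilon> \<epsilon>' k = (\<Sum>l<p. if c l = k then bool_sign (\<epsilon> l) * bool_sign (\<epsilon>' l) / block_size k else 0)"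

lemma finite_S: "finite S"
  using S finite_subset by blast

lemma c_less: "j < p \<Longrightarrow> c j < p"
  using c_in S by blast

lemma block_size_ge: "s \<in> S \<Longrightarrow> m \<le> block_size s"
  using m by (simp add: block_size_def)

lemma block_size_pos: "s \<in> S \<Longrightarrow> block_size s > 0"
  using block_size_ge m(1) by fastforce

lemma sum_block: "(\<Sum>l<p. if c l = k then x else 0) = block_size k * x" for x :: real
proof -
  have "(\<Sum>l<p. if c l = k then x else 0) = (\<Sum>l\<in>{l \<in> {..<p}. c l = k}. x)"
    by (rule sum.inter_filter[symmetric]) simp
  then show ?thesis by (simp add: block_size_def)
qed

lemma overlap_bound: "\<bar>overlap \<epsilon> \<epsilon>' k\<bar> \<le> 1"
proof -
  have "\<bar>overlap \<epsilon> \<epsilon>' k\<bar> \<le> (\<Sum>l<p. \<bar>if c l = k then bool_sign (\<epsilon> l) * bool_sign (\<epsilon>' l) / block_size k else 0\<bar>)"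
    unfolding overlap_def by (rule sum_abs)
  also have "\<dots> \<le> (\<Sum>l<p. if c l = k then 1 / block_size k else 0)"
    by (intro sum_mono) (auto simp: bool_sign_def block_size_def)
  \<comment> \<open>An inequality rather than an equality: if the block of \<open>k\<close> is
    empty, the left side is \<open>0\<close>.\<close>
  also have "\<dots> \<le> 1" by (simp add: sum_block)
  finally show ?thesis .
qed

lemma measurable_bool_sign [measurable]:
  "l < p \<Longrightarrow> (\<lambda>\<epsilon>. bool_sign (\<epsilon> l)) \<in> borel_measurable (coins p)"
  by (rule measurable_compose[OF measurable_component_singleton]) auto

lemma measurable_sign_frame [measurable]: "sign_frame \<in> coins p \<rightarrow>\<^sub>M mat_space p p"
  unfolding sign_frame_def case_prod_beta
  by (rule measurable_restrict) auto

lemma measurable_overlap [measurable (raw)]: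
  assumes [measurable]: "f \<in> N \<rightarrow>\<^sub>M coins p" "g \<in> N \<rightarrow>\<^sub>M coins p"
  shows "(\<lambda>x. overlap (f x) (g x) k) \<in> borel_measurable N"
proof -
  have "(\<lambda>x. bool_sign (f x l)) \<in> borel_measurable N" "(\<lambda>x. bool_sign (g x l)) \<in> borel_measurable N"
    if "l < p" for l
    using measurable_compose[OF assms(1) measurable_bool_sign[OF that]]
      measurable_compose[OF assms(2) measurable_bool_sign[OF that]] by auto
  then show ?thesis
    unfolding overlap_def by (intro borel_measurable_sum) auto
qed

text \<open>Both signals are images under the same \<open>Q\<close>, so the isometry removes it.
  What remains is the Gram matrix of two sign frames, which is diagonal, so column \<open>k\<close>
  of \<open>z\<close> meets only column \<open>k\<close> of \<open>z'\<close>.\<close>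

lemma signal_inner:
  assumes Q: "Q \<in> orthogonal_group p" and a: "a \<ge> 0"
  shows "(\<Sum>ij\<in>{..<n} \<times> {..<p}. signal a S (sq_mat_mult p Q (sign_frame \<epsilon>)) z ij *
      signal a S (sq_mat_mult p Q (sign_frame \<epsilon>')) z' ij) =
    (\<Sum>ik\<in>{..<n} \<times> {..<p}. a * overlap \<epsilon> \<epsilon>' (snd ik) * z ik * z' ik)"
proof -
  \<comment> \<open>The coordinates of the \<open>i\<close>-th signal vector, without the factor
    \<open>sqrt a\<close>, in the orthonormal basis formed by the columns of \<open>Q\<close>. Row
    \<open>l\<close> of the frame has its only nonzero entry in column \<open>c l\<close>.\<close>
  define y where "y \<epsilon> z i l = z (i, c l) * bool_sign (\<epsilon> l) / sqrt (block_size (c l))"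
    for \<epsilon> :: "nat \<Rightarrow> bool" and z :: "nat \<times> nat \<Rightarrow> real" and i l
  have sig: "signal a S (sq_mat_mult p Q (sign_frame \<epsilon>)) z (i, j) = sqrt a * (\<Sum>l<p. Q (j, l) * y \<epsilon> z i l)"
    if j: "j < p" for \<epsilon> z i j
  proof -
    have "(\<Sum>k\<in>S. z (i, k) * sq_mat_mult p Q (sign_frame \<epsilon>) (j, k)) =
      (\<Sum>k\<in>S. \<Sum>l<p. Q (j, l) * (if c l = k then z (i, k) * bool_sign (\<epsilon> l) / sqrt (block_size k) else 0))"
      using j S by (intro sum.cong refl)
        (auto simp: sq_mat_mult_def sign_frame_def sum_distrib_left intro!: sum.cong)
    also have "\<dots> = (\<Sum>l<p. \<Sum>k\<in>S. Q (j, l) * (if c l = k then z (i, k) * bool_sign (\<epsilon> l) / sqrt (block_size k) else 0))"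
      by (rule sum.swap)
    also have "\<dots> = (\<Sum>l<p. Q (j, l) * y \<epsilon> z i l)"
      using c_in finite_S by (intro sum.cong refl) (simp add: y_def flip: sum_distrib_left)
    finally show ?thesis by (simp add: signal_def)
  qed
  have "(\<Sum>ij\<in>{..<n} \<times> {..<p}. signal a S (sq_mat_mult p Q (sign_frame \<epsilon>)) z ij *
      signal a S (sq_mat_mult p Q (sign_frame \<epsilon>')) z' ij) =
    (\<Sum>i<n. \<Sum>j<p. a * ((\<Sum>l<p. Q (j, l) * y \<epsilon> z i l) * (\<Sum>l<p. Q (j, l) * y \<epsilon>' z' i l)))"
  proof -
    have ss: "sqrt a * x * (sqrt a * y) = a * (x * y)" for x y
    proof -
      have "sqrt a * x * (sqrt a * y) = (sqrt a * sqrt a) * (x * y)" by (simp only: mult_ac)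
      then show ?thesis using a by simp
    qed
    show ?thesis by (simp add: sum.cartesian_product' sig) (intro sum.cong refl ss)
  qed
  also have "\<dots> = (\<Sum>i<n. a * (\<Sum>l<p. y \<epsilon> z i l * y \<epsilon>' z' i l))"
    by (simp add: orthogonal_group_inner[OF Q] flip: sum_distrib_left)
  also have "\<dots> = (\<Sum>i<n. \<Sum>k<p. a * overlap \<epsilon> \<epsilon>' k * z (i, k) * z' (i, k))"
  proof (intro sum.cong refl)
    fix i
    have "(\<Sum>k<p. overlap \<epsilon> \<epsilon>' k * z (i, k) * z' (i, k)) =
      (\<Sum>k<p. \<Sum>l<p. if c l = k then bool_sign (\<epsilon> l) * bool_sign (\<epsilon>' l) / block_size k * z (i, k) * z' (i, k) else 0)"
      by (simp add: overlap_def sum_distrib_right if_distrib if_distribR cong: if_cong)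
    also have "\<dots> = (\<Sum>l<p. \<Sum>k<p. if c l = k then bool_sign (\<epsilon> l) * bool_sign (\<epsilon>' l) / block_size k * z (i, k) * z' (i, k) else 0)"
      by (rule sum.swap)
    also have "\<dots> = (\<Sum>l<p. y \<epsilon> z i l * y \<epsilon>' z' i l)"
      using block_size_pos[OF c_in] by (intro sum.cong refl) (simp add: y_def c_less less_imp_le)
    finally show "a * (\<Sum>l<p. y \<epsilon> z i l * y \<epsilon>' z' i l) = (\<Sum>k<p. a * overlap \<epsilon> \<epsilon>' k * z (i, k) * z' (i, k))"
      by (simp add: sum_distrib_left[symmetric] mult.assoc)
  qed
  finally show ?thesis by (simp add: sum.cartesian_product')
qed

text \<open>
  The quadratic exponent is linearised by an auxiliary Gaussian vector, after which the signs
  \<open>\<epsilon>'\<close> factorise.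
\<close>

lemma overlap_exp_square_le:
  assumes t: "0 \<le> t" "2 * t / m \<le> 1 / 2"
  shows "(\<integral>\<^sup>+\<epsilon>'. ennreal (exp (t * (\<Sum>k<p. (overlap \<epsilon> \<epsilon>' k)\<^sup>2))) \<partial>coins p) \<le>
    ennreal (exp (card S * (2 * t / m)))"
proof -
  interpret pair_sigma_finite "coins p" "gauss {..<p}" ..
  define h where "h g l = sqrt (2 * t) * g (c l) / block_size (c l) * bool_sign (\<epsilon> l)" for g :: "nat \<Rightarrow> real" and l
  have lin: "(\<Sum>k<p. sqrt (2 * t) * overlap \<epsilon> \<epsilon>' k * g k) = (\<Sum>l<p. h g l * bool_sign (\<epsilon>' l))" for g \<epsilon>'
  proof -
    have "(\<Sum>k<p. sqrt (2 * t) * overlap \<epsilon> \<epsilon>' k * g k) =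
      (\<Sum>k<p. \<Sum>l<p. if c l = k then sqrt (2 * t) * (bool_sign (\<epsilon> l) * bool_sign (\<epsilon>' l) / block_size k) * g k else 0)"
      by (simp add: overlap_def sum_distrib_left sum_distrib_right if_distrib if_distribR cong: if_cong)
    also have "\<dots> = (\<Sum>l<p. \<Sum>k<p. if c l = k then sqrt (2 * t) * (bool_sign (\<epsilon> l) * bool_sign (\<epsilon>' l) / block_size k) * g k else 0)"
      by (rule sum.swap)
    also have "\<dots> = (\<Sum>l<p. h g l * bool_sign (\<epsilon>' l))"
      by (intro sum.cong refl) (simp add: h_def c_less)
    finally show ?thesis .
  qed
  \<comment> \<open>A block contributes \<open>block_size s\<close> equal terms, each with
    \<open>(block_size s)^2\<close> in the denominator. One factor survives, and this is the gain
    \<open>1 / m\<close>.\<close>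
  have hsq: "(\<Sum>l<p. (h g l)\<^sup>2) / 2 = (\<Sum>s\<in>S. 2 * t / block_size s * (g s)\<^sup>2 / 2)" for g
  proof -
    have "(\<Sum>l<p. (h g l)\<^sup>2) = (\<Sum>l<p. \<Sum>s\<in>S. if c l = s then 2 * t * (g s)\<^sup>2 / (block_size s)\<^sup>2 else 0)"
      using t finite_S c_in by (intro sum.cong refl) (simp add: h_def power_mult_distrib power_divide)
    also have "\<dots> = (\<Sum>s\<in>S. \<Sum>l<p. if c l = s then 2 * t * (g s)\<^sup>2 / (block_size s)\<^sup>2 else 0)"
      by (rule sum.swap)
    also have "\<dots> = (\<Sum>s\<in>S. 2 * t / block_size s * (g s)\<^sup>2)"
      using block_size_pos by (intro sum.cong refl) (auto simp: sum_block power2_eq_square dest!: block_size_pos)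
    finally show ?thesis by (simp add: sum_divide_distrib)
  qed
  have "(\<integral>\<^sup>+\<epsilon>'. ennreal (exp (t * (\<Sum>k<p. (overlap \<epsilon> \<epsilon>' k)\<^sup>2))) \<partial>coins p) =
    (\<integral>\<^sup>+\<epsilon>'. \<integral>\<^sup>+g. ennreal (exp (\<Sum>k<p. sqrt (2 * t) * overlap \<epsilon> \<epsilon>' k * g k)) \<partial>gauss {..<p} \<partial>coins p)"
    using t by (subst gauss_exp_linear) (auto simp: power_mult_distrib sum_distrib_left sum_divide_distrib)
  also have "\<dots> = (\<integral>\<^sup>+\<epsilon>'. \<integral>\<^sup>+g. ennreal (exp (\<Sum>l<p. h g l * bool_sign (\<epsilon>' l))) \<partial>gauss {..<p} \<partial>coins p)"
    unfolding lin ..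
  also have "\<dots> = (\<integral>\<^sup>+g. \<integral>\<^sup>+\<epsilon>'. ennreal (exp (\<Sum>l<p. h g l * bool_sign (\<epsilon>' l))) \<partial>coins p \<partial>gauss {..<p})"
    unfolding h_def using c_less
    by (intro Fubini'[symmetric]) measurable
  also have "\<dots> \<le> (\<integral>\<^sup>+g. ennreal (exp (\<Sum>s\<in>S. 2 * t / block_size s * (g s)\<^sup>2 / 2)) \<partial>gauss {..<p})"
    by (intro nn_integral_mono order_trans[OF coins_exp_linear_le]) (simp add: hsq)
  also have "\<dots> = (\<integral>\<^sup>+g. ennreal (exp (\<Sum>s<p. (if s \<in> S then 2 * t / block_size s else 0) * (g s)\<^sup>2 / 2)) \<partial>gauss {..<p})"
    using S by (intro nn_integral_cong arg_cong[where f = "\<lambda>x. ennreal (exp x)"] sum.mono_neutral_cong_left) auto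
  also have "\<dots> \<le> ennreal (exp (\<Sum>s<p. if s \<in> S then 2 * t / block_size s else 0))"
  proof (intro gauss_exp_square_le)
    fix s
    show "0 \<le> (if s \<in> S then 2 * t / block_size s else 0) \<and> (if s \<in> S then 2 * t / block_size s else 0) \<le> 1 / 2"
    proof (cases "s \<in> S")
      case True
      then have "2 * t / block_size s \<le> 2 * t / m"
        using m(1) t block_size_ge[OF True] by (intro divide_left_mono mult_pos_pos) auto
      then have "2 * t / block_size s \<le> 1 / 2" using t by linarith
      then show ?thesis using True t block_size_pos[OF True] by (simp del: divide_le_eq_numeral1)
    qed simp
  qed simp
  also have "\<dots> \<le> ennreal (exp (card S * (2 * t / m)))"
  proof -
    have "(\<Sum>s<p. if s \<in> S then 2 * t / block_size s else 0) = (\<Sum>s\<in>S. 2 * t / block_size s)"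
      using S by (intro sum.mono_neutral_cong_right) auto
    also have "\<dots> \<le> (\<Sum>s\<in>S. 2 * t / m)"
      using m(1) t block_size_ge block_size_pos by (intro sum_mono divide_left_mono mult_pos_pos) auto
    finally show ?thesis by (simp add: ennreal_leI)
  qed
  finally show ?thesis .
qed

text \<open>Integrating \<open>z'\<close> gives squares of the \<open>z\<close> coordinates,
  integrating \<open>z\<close> then gives \<open>exp\<close> of \<open>n * a^2\<close> times the sum
  of squared overlaps, and the signs \<epsilon>' are averaged last with \<open>t = n * a^2\<close>.
  The resulting bound is uniform in \<epsilon>, so the outer average costs nothing.\<close>

lemma signal_second_moment:
  fixes n :: nat and a :: real
  assumes Q: "Q \<in> orthogonal_group p" and a: "0 \<le> a" "a\<^sup>2 \<le> 1 / 2" "2 * (n * a\<^sup>2) / m \<le> 1 / 2"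
  defines "W \<equiv> coins p \<Otimes>\<^sub>M gaussian_mat n p"
    and "\<mu> \<equiv> (\<lambda>(\<epsilon>, z). signal a S (sq_mat_mult p Q (sign_frame \<epsilon>)) z)"
  shows "(\<integral>\<^sup>+w. \<integral>\<^sup>+w'. ennreal (exp (\<Sum>ij\<in>{..<n} \<times> {..<p}. \<mu> w ij * \<mu> w' ij)) \<partial>W \<partial>W) \<le>
    ennreal (exp (card S * (2 * (n * a\<^sup>2) / m)))"
proof -
  let ?I = "{..<n} \<times> {..<p}"
  interpret gc: pair_sigma_finite "gauss ?I" "coins p" ..
  have W: "W = coins p \<Otimes>\<^sub>M gauss ?I" by (simp add: W_def gaussian_mat_def)
  interpret W: prob_space W unfolding W by (intro prob_space_pair gauss.prob_space_axioms coins.prob_space_axioms)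
  define F where "F \<epsilon> z \<epsilon>' z' = ennreal (exp (\<Sum>ik\<in>?I. a * overlap \<epsilon> \<epsilon>' (snd ik) * z ik * z' ik))" for \<epsilon> z \<epsilon>' z'
  have Feq: "ennreal (exp (\<Sum>ij\<in>?I. \<mu> w ij * \<mu> w' ij)) = F (fst w) (snd w) (fst w') (snd w')" for w w'
    unfolding F_def \<mu>_def case_prod_beta by (subst signal_inner[OF Q a(1)]) simp
  have Fmeas [measurable]: "(\<lambda>x. F (e x) (f x) (e' x) (f' x)) \<in> borel_measurable N"
    if [measurable]: "e \<in> N \<rightarrow>\<^sub>M coins p" "e' \<in> N \<rightarrow>\<^sub>M coins p" "f \<in> N \<rightarrow>\<^sub>M gauss ?I" "f' \<in> N \<rightarrow>\<^sub>M gauss ?I"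
    for N :: "'z measure" and e e' f f'
  proof -
    have "(\<lambda>x. f x ik) \<in> borel_measurable N" "(\<lambda>x. f' x ik) \<in> borel_measurable N" if "ik \<in> ?I" for ik
      using that by (auto intro!: measurable_compose[OF \<open>f \<in> _\<close>] measurable_compose[OF \<open>f' \<in> _\<close>])
    then show ?thesis
      unfolding F_def by measurable
  qed
  have z': "(\<integral>\<^sup>+z'. F \<epsilon> z \<epsilon>' z' \<partial>gauss ?I) =
    ennreal (exp (\<Sum>ik\<in>?I. (a * overlap \<epsilon> \<epsilon>' (snd ik))\<^sup>2 * (z ik)\<^sup>2 / 2))" for \<epsilon> z \<epsilon>'
    unfolding F_def by (subst gauss_exp_linear) (auto simp: power_mult_distrib sum_divide_distrib)
  have z: "(\<integral>\<^sup>+z. \<integral>\<^sup>+z'. F \<epsilon> z \<epsilon>' z' \<partial>gauss ?I \<partial>gauss ?I) \<le>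
    ennreal (exp (n * a\<^sup>2 * (\<Sum>k<p. (overlap \<epsilon> \<epsilon>' k)\<^sup>2)))" for \<epsilon> \<epsilon>'
  proof -
    have "(\<integral>\<^sup>+z. \<integral>\<^sup>+z'. F \<epsilon> z \<epsilon>' z' \<partial>gauss ?I \<partial>gauss ?I) \<le> ennreal (exp (\<Sum>ik\<in>?I. (a * overlap \<epsilon> \<epsilon>' (snd ik))\<^sup>2))"
      unfolding z'
    proof (intro gauss_exp_square_le conjI)
      fix ik
      have "(overlap \<epsilon> \<epsilon>' (snd ik))\<^sup>2 \<le> 1" using overlap_bound by (simp add: abs_square_le_1)
      then have "a\<^sup>2 * (overlap \<epsilon> \<epsilon>' (snd ik))\<^sup>2 \<le> 1 / 2 * 1" using a by (intro mult_mono) auto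
      then show "(a * overlap \<epsilon> \<epsilon>' (snd ik))\<^sup>2 \<le> 1 / 2" by (simp add: power_mult_distrib)
    qed auto
    also have "(\<Sum>ik\<in>?I. (a * overlap \<epsilon> \<epsilon>' (snd ik))\<^sup>2) = n * a\<^sup>2 * (\<Sum>k<p. (overlap \<epsilon> \<epsilon>' k)\<^sup>2)"
      by (simp add: sum.cartesian_product' power_mult_distrib sum_distrib_left mult_ac)
    finally show ?thesis .
  qed
  have "(\<integral>\<^sup>+w. \<integral>\<^sup>+w'. ennreal (exp (\<Sum>ij\<in>?I. \<mu> w ij * \<mu> w' ij)) \<partial>W \<partial>W) =
    (\<integral>\<^sup>+w. \<integral>\<^sup>+w'. F (fst w) (snd w) (fst w') (snd w') \<partial>W \<partial>W)"
    by (simp only: Feq)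
  also have "\<dots> = (\<integral>\<^sup>+\<epsilon>. \<integral>\<^sup>+z. \<integral>\<^sup>+\<epsilon>'. \<integral>\<^sup>+z'. F \<epsilon> z \<epsilon>' z' \<partial>gauss ?I \<partial>coins p \<partial>gauss ?I \<partial>coins p)"
  proof -
    have fstW: "(\<integral>\<^sup>+w. f w \<partial>W) = (\<integral>\<^sup>+\<epsilon>. \<integral>\<^sup>+z. f (\<epsilon>, z) \<partial>gauss ?I \<partial>coins p)"
      if "f \<in> borel_measurable (coins p \<Otimes>\<^sub>M gauss ?I)" for f
      unfolding W by (rule gauss.nn_integral_fst[symmetric]) (rule that)
    have "(\<integral>\<^sup>+w'. F \<epsilon> z (fst w') (snd w') \<partial>W) = (\<integral>\<^sup>+\<epsilon>'. \<integral>\<^sup>+z'. F \<epsilon> z \<epsilon>' z' \<partial>gauss ?I \<partial>coins p)"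
      if "\<epsilon> \<in> space (coins p)" "z \<in> space (gauss ?I)" for \<epsilon> z
      using that by (subst fstW) auto
    then have "(\<integral>\<^sup>+w. \<integral>\<^sup>+w'. F (fst w) (snd w) (fst w') (snd w') \<partial>W \<partial>W) =
      (\<integral>\<^sup>+w. \<integral>\<^sup>+\<epsilon>'. \<integral>\<^sup>+z'. F (fst w) (snd w) \<epsilon>' z' \<partial>gauss ?I \<partial>coins p \<partial>W)"
      by (intro nn_integral_cong) (auto simp: W space_pair_measure)
    also have "\<dots> = (\<integral>\<^sup>+\<epsilon>. \<integral>\<^sup>+z. \<integral>\<^sup>+\<epsilon>'. \<integral>\<^sup>+z'. F \<epsilon> z \<epsilon>' z' \<partial>gauss ?I \<partial>coins p \<partial>gauss ?I \<partial>coins p)"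
      by (subst fstW) auto
    finally show ?thesis .
  qed
  \<comment> \<open>Fubini brings the two Gaussian integrals together, so that both are evaluated
    for fixed signs.\<close>
  also have "\<dots> = (\<integral>\<^sup>+\<epsilon>. \<integral>\<^sup>+\<epsilon>'. \<integral>\<^sup>+z. \<integral>\<^sup>+z'. F \<epsilon> z \<epsilon>' z' \<partial>gauss ?I \<partial>gauss ?I \<partial>coins p \<partial>coins p)"
    by (intro nn_integral_cong gc.Fubini'[symmetric]) measurable
  also have "\<dots> \<le> (\<integral>\<^sup>+\<epsilon>. \<integral>\<^sup>+\<epsilon>'. ennreal (exp (n * a\<^sup>2 * (\<Sum>k<p. (overlap \<epsilon> \<epsilon>' k)\<^sup>2))) \<partial>coins p \<partial>coins p)"
    by (intro nn_integral_mono z)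
  also have "\<dots> \<le> (\<integral>\<^sup>+\<epsilon>. ennreal (exp (card S * (2 * (n * a\<^sup>2) / m))) \<partial>coins p)"
    using a by (intro nn_integral_mono overlap_exp_square_le) auto
  also have "\<dots> = ennreal (exp (card S * (2 * (n * a\<^sup>2) / m)))"
    by (simp add: coins.emeasure_space_1)
  finally show ?thesis .
qed

end

subsection \<open>Lower bound for the errors of a test\<close>

text \<open>Right invariance holds for each sign vector separately, so it survives averaging over
  the signs. Fubini then puts \<open>Q\<close> outermost, and the mixture bound applies for almost
  every \<open>Q\<close> with a right-hand side free of \<open>Q\<close>.\<close>

lemma (in block_partition) haar_signal_test_le:
  fixes n :: nat and a \<xi> :: real
  assumes H: "is_haar_orthogonal p H"
    and a: "0 \<le> a" "a\<^sup>2 \<le> 1 / 2" "2 * (n * a\<^sup>2) / m \<le> 1 / 2"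
    and \<xi>: "exp (card S * (2 * (n * a\<^sup>2) / m)) \<le> 1 + \<xi>" "\<xi> > 0"
    and \<phi>: "\<phi> \<in> tests n p"
  defines "I \<equiv> {..<n} \<times> {..<p}"
  shows "(\<integral>\<^sup>+Q. \<integral>\<^sup>+z. \<integral>\<^sup>+x. ennreal (\<phi> (\<lambda>ij\<in>I. x ij + signal a S Q z ij)) \<partial>gauss I \<partial>gauss I \<partial>H) \<le>
    (\<integral>\<^sup>+x. ennreal (\<phi> x) \<partial>gauss I) + ennreal (sqrt \<xi>)"
proof -
  interpret H: prob_space H using H by (simp add: is_haar_orthogonal_def)
  interpret HC: pair_sigma_finite H "coins p" ..
  have [measurable_cong]: "sets H = sets (mat_space p p)"
    using H by (simp add: is_haar_orthogonal_def)
  have \<phi>m: "\<phi> \<in> borel_measurable (PiM I (\<lambda>_. borel))" using \<phi> by (simp add: tests_def I_def)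
  have \<phi>01: "0 \<le> \<phi> x \<and> \<phi> x \<le> 1" if "x \<in> space (PiM I (\<lambda>_. borel))" for x
    using \<phi> that by (simp add: tests_def I_def)
  obtain G where G: "\<And>\<epsilon>. G \<epsilon> \<in> orthogonal_group p"
    "\<And>\<epsilon> s j. s \<in> S \<Longrightarrow> j < p \<Longrightarrow> G \<epsilon> (j, s) =
      (if c j = s then bool_sign (\<epsilon> j) / sqrt (card {i \<in> {..<p}. c i = s}) else 0)"
    using ex_block_sign_orthogonal[OF S c_in c_id] by blast
  define F where "F Q z = (\<integral>\<^sup>+x. ennreal (\<phi> (\<lambda>ij\<in>I. x ij + signal a S Q z ij)) \<partial>gauss I)" for Q z
  have comp: "(\<lambda>w. ennreal (\<phi> (\<lambda>ij\<in>I. h w ij))) \<in> borel_measurable N"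
    if "\<And>ij. ij \<in> I \<Longrightarrow> (\<lambda>w. h w ij) \<in> borel_measurable N" for N :: "'z measure" and h
    using that by (intro measurable_compose[OF _ measurable_ennreal] measurable_compose[OF _ \<phi>m] measurable_restrict) auto
  have Fm [measurable]: "(\<lambda>w. F (f w) (g w)) \<in> borel_measurable N"
    if [measurable]: "f \<in> N \<rightarrow>\<^sub>M mat_space p p" "g \<in> N \<rightarrow>\<^sub>M gauss I" for f g and N :: "'z measure"
  proof -
    have [measurable]: "g \<in> N \<rightarrow>\<^sub>M mat_space n p"
      using that(2) unfolding I_def measurable_cong_sets[OF refl sets_gauss] .
    have "(\<lambda>wx. ennreal (\<phi> (\<lambda>ij\<in>I. snd wx ij + signal a S (f (fst wx)) (g (fst wx)) ij))) \<in>
      borel_measurable (N \<Otimes>\<^sub>M gauss I)"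
    proof (rule comp)
      fix ij assume ij: "ij \<in> I"
      have "(\<lambda>w. signal a S (f (fst w)) (g (fst w)) ij) \<in> borel_measurable (N \<Otimes>\<^sub>M gauss I)"
        by (rule measurable_signal[where n = n and p = p]) (use S ij in \<open>auto simp: I_def\<close>)
      moreover have "(\<lambda>w. snd w ij) \<in> borel_measurable (N \<Otimes>\<^sub>M gauss I)"
        using ij by measurable
      ultimately show "(\<lambda>w. snd w ij + signal a S (f (fst w)) (g (fst w)) ij) \<in> borel_measurable (N \<Otimes>\<^sub>M gauss I)"
        by (rule borel_measurable_add[OF _ _, rotated])
    qed
    then show ?thesis unfolding F_def by measurable
  qed
  have rot: "(\<integral>\<^sup>+Q. \<integral>\<^sup>+z. F Q z \<partial>gauss I \<partial>H) = (\<integral>\<^sup>+Q. \<integral>\<^sup>+z. F (sq_mat_mult p Q (sign_frame \<epsilon>)) z \<partial>gauss I \<partial>H)" for \<epsilon>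
  proof -
    have "(\<integral>\<^sup>+Q. \<integral>\<^sup>+z. F Q z \<partial>gauss I \<partial>H) = (\<integral>\<^sup>+Q. \<integral>\<^sup>+z. F (sq_mat_mult p Q (G \<epsilon>)) z \<partial>gauss I \<partial>H)"
      by (rule haar_right_invariant[OF H G(1), symmetric]) measurable
    \<comment> \<open>The witness \<open>G\<close> is not known to depend measurably on \<epsilon>.
      It is therefore exchanged for the explicit frame, which agrees with it in the columns that
      matter, before the signs are integrated.\<close>
    also have "signal a S (sq_mat_mult p Q (G \<epsilon>)) z ij = signal a S (sq_mat_mult p Q (sign_frame \<epsilon>)) z ij"
      if "ij \<in> I" for Q z ij
    proof -
      have "sq_mat_mult p Q (G \<epsilon>) (j, k) = sq_mat_mult p Q (sign_frame \<epsilon>) (j, k)" if "j < p" "k \<in> S" for j k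
        using that S by (auto simp: sq_mat_mult_def sign_frame_def block_size_def G(2) intro!: sum.cong)
      then show ?thesis using that by (auto simp: signal_def I_def)
    qed
    then have "(\<integral>\<^sup>+Q. \<integral>\<^sup>+z. F (sq_mat_mult p Q (G \<epsilon>)) z \<partial>gauss I \<partial>H) =
      (\<integral>\<^sup>+Q. \<integral>\<^sup>+z. F (sq_mat_mult p Q (sign_frame \<epsilon>)) z \<partial>gauss I \<partial>H)"
      unfolding F_def by (simp cong: restrict_cong)
    finally show ?thesis .
  qed
  have "(\<integral>\<^sup>+Q. \<integral>\<^sup>+z. F Q z \<partial>gauss I \<partial>H) =
    (\<integral>\<^sup>+\<epsilon>. \<integral>\<^sup>+Q. \<integral>\<^sup>+z. F (sq_mat_mult p Q (sign_frame \<epsilon>)) z \<partial>gauss I \<partial>H \<partial>coins p)"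
    by (simp add: rot[symmetric] coins.emeasure_space_1)
  also have "\<dots> = (\<integral>\<^sup>+Q. \<integral>\<^sup>+\<epsilon>. \<integral>\<^sup>+z. F (sq_mat_mult p Q (sign_frame \<epsilon>)) z \<partial>gauss I \<partial>coins p \<partial>H)"
    by (rule HC.Fubini') measurable
  also have "\<dots> \<le> (\<integral>\<^sup>+Q. (\<integral>\<^sup>+x. ennreal (\<phi> x) \<partial>gauss I) + ennreal (sqrt \<xi>) \<partial>H)"
  proof (rule nn_integral_mono_AE)
    have "AE Q in H. Q \<in> orthogonal_group p" using H by (simp add: is_haar_orthogonal_def)
    then show "AE Q in H. (\<integral>\<^sup>+\<epsilon>. \<integral>\<^sup>+z. F (sq_mat_mult p Q (sign_frame \<epsilon>)) z \<partial>gauss I \<partial>coins p) \<le>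
      (\<integral>\<^sup>+x. ennreal (\<phi> x) \<partial>gauss I) + ennreal (sqrt \<xi>)"
    proof eventually_elim
      case (elim Q)
      let ?W = "coins p \<Otimes>\<^sub>M gaussian_mat n p"
      let ?\<mu> = "\<lambda>(\<epsilon>, z). signal a S (sq_mat_mult p Q (sign_frame \<epsilon>)) z"
      have W: "?W = coins p \<Otimes>\<^sub>M gauss I" by (simp add: gaussian_mat_def I_def)
      have Qs [measurable]: "Q \<in> space (mat_space p p)"
        using elim by (auto simp: orthogonal_group_def space_PiM PiE_def)
      have "(\<integral>\<^sup>+\<epsilon>. \<integral>\<^sup>+z. F (sq_mat_mult p Q (sign_frame \<epsilon>)) z \<partial>gauss I \<partial>coins p) =
        (\<integral>\<^sup>+w. F (sq_mat_mult p Q (sign_frame (fst w))) (snd w) \<partial>?W)"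
        unfolding W by (subst gauss.nn_integral_fst[symmetric]) auto
      also have "\<dots> = (\<integral>\<^sup>+w. \<integral>\<^sup>+x. ennreal (\<phi> (\<lambda>ij\<in>I. x ij + ?\<mu> w ij)) \<partial>gauss I \<partial>?W)"
        by (simp add: F_def case_prod_beta)
      also have "\<dots> \<le> (\<integral>\<^sup>+x. ennreal (\<phi> x) \<partial>gauss I) + ennreal (sqrt \<xi>)"
      proof (rule gauss_mixture_bound)
        show "finite I" by (simp add: I_def)
        show "prob_space ?W"
          unfolding W by (intro prob_space_pair gauss.prob_space_axioms coins.prob_space_axioms)
        show "(\<lambda>w. ?\<mu> w ij) \<in> borel_measurable ?W" if "ij \<in> I" for ij
        proof -
          have [measurable]: "snd \<in> ?W \<rightarrow>\<^sub>M mat_space n p" unfolding W I_def by measurable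
          have [measurable]: "(\<lambda>w. sq_mat_mult p Q (sign_frame (fst w))) \<in> ?W \<rightarrow>\<^sub>M mat_space p p"
            by measurable
          show ?thesis unfolding case_prod_beta
            by (rule measurable_signal[where n = n and p = p]) (use S that in \<open>auto simp: I_def\<close>)
        qed
        have "(\<integral>\<^sup>+w. \<integral>\<^sup>+w'. ennreal (exp (\<Sum>ij\<in>I. ?\<mu> w ij * ?\<mu> w' ij)) \<partial>?W \<partial>?W) \<le>
          ennreal (exp (card S * (2 * (n * a\<^sup>2) / m)))"
          unfolding I_def by (rule signal_second_moment[OF elim a])
        also have "\<dots> \<le> ennreal (1 + \<xi>)" by (intro ennreal_leI \<xi>)
        finally show "(\<integral>\<^sup>+w. \<integral>\<^sup>+w'. ennreal (exp (\<Sum>ij\<in>I. ?\<mu> w ij * ?\<mu> w' ij)) \<partial>?W \<partial>?W) \<le> ennreal (1 + \<xi>)" .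
      qed (use \<xi> \<phi>m \<phi>01 in auto)
      finally show ?case .
    qed
  qed
  also have "\<dots> = (\<integral>\<^sup>+x. ennreal (\<phi> x) \<partial>gauss I) + ennreal (sqrt \<xi>)"
    by (simp add: H.emeasure_space_1)
  finally show ?thesis unfolding F_def .
qed

section \<open>The model as an iterated integral, with the orthogonal matrix outermost\<close>

lemma sets_model:
  assumes "is_haar_orthogonal p H"
  shows "sets (model n p H) = sets (mat_space p p \<Otimes>\<^sub>M (mat_space n p \<Otimes>\<^sub>M mat_space n p))"
  using assms unfolding model_def is_haar_orthogonal_def gaussian_mat_def
  by (intro sets_pair_measure_cong sets_gauss) auto

lemma nn_integral_model:
  assumes "is_haar_orthogonal p H"
    and "f \<in> borel_measurable (mat_space p p \<Otimes>\<^sub>M (mat_space n p \<Otimes>\<^sub>M mat_space n p))"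
  shows "(\<integral>\<^sup>+\<omega>. f \<omega> \<partial>model n p H) =
    (\<integral>\<^sup>+Q. \<integral>\<^sup>+z. \<integral>\<^sup>+x. f (Q, z, x) \<partial>gauss ({..<n} \<times> {..<p}) \<partial>gauss ({..<n} \<times> {..<p}) \<partial>H)"
proof -
  let ?g = "gauss ({..<n} \<times> {..<p})"
  interpret gg: pair_sigma_finite ?g ?g ..
  have sH [measurable_cong]: "sets H = sets (mat_space p p)"
    using assms by (simp add: is_haar_orthogonal_def)
  have [measurable]: "f \<in> borel_measurable (H \<Otimes>\<^sub>M (?g \<Otimes>\<^sub>M ?g))"
    using assms(2) sets_model[OF assms(1), of n]
    by (simp add: model_def gaussian_mat_def cong: measurable_cong_sets)
  have "(\<integral>\<^sup>+\<omega>. f \<omega> \<partial>model n p H) = (\<integral>\<^sup>+Q. \<integral>\<^sup>+y. f (Q, y) \<partial>(?g \<Otimes>\<^sub>M ?g) \<partial>H)"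
    unfolding model_def gaussian_mat_def by (rule gg.nn_integral_fst[symmetric]) measurable
  also have "\<dots> = (\<integral>\<^sup>+Q. \<integral>\<^sup>+z. \<integral>\<^sup>+x. f (Q, z, x) \<partial>?g \<partial>?g \<partial>H)"
    by (intro nn_integral_cong gauss.nn_integral_fst[symmetric]) measurable
  finally show ?thesis .
qed

lemma prob_space_model:
  assumes "is_haar_orthogonal p H"
  shows "prob_space (model n p H)"
  using assms unfolding model_def gaussian_mat_def is_haar_orthogonal_def
  by (intro prob_space_pair gauss.prob_space_axioms) auto

lemma transmitted_eq_signal:
  "transmitted n p \<delta> \<eta> (Q, z, x) =
    (\<lambda>ij \<in> {..<n} \<times> {..<p}. x ij + signal (\<delta> / (1 - \<delta>)) {k \<in> {..<p}. \<eta> k = 1} Q z ij)"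
  by (auto simp: transmitted_def signal_def fun_eq_iff)

lemma sparse_binary_vecs_support:
  assumes "\<eta> \<in> sparse_binary_vecs p r"
  shows "card {k \<in> {..<p}. \<eta> k = 1} = r"
proof -
  have "{k \<in> {..<p}. \<eta> k = 1} = {k \<in> {..<p}. \<eta> k \<noteq> 0}"
    using assms by (auto simp: sparse_binary_vecs_def binary_vecs_def PiE_def Pi_def)
  then show ?thesis using assms by (simp add: sparse_binary_vecs_def)
qed

text \<open>The two errors add up to \<open>1\<close> minus the difference of the mean of
  \<open>\<phi>\<close> under the alternative and under the null, so it is enough that this
  difference is at most \<open>sqrt \<xi>\<close>. The blocks are those of the support of
  \<open>\<eta>\<close>, with \<open>m = p div r\<close>.\<close>

lemma sum_of_errors_ge:
  fixes n p r :: nat and \<delta> \<xi> a :: real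
  defines "a \<equiv> \<delta> / (1 - \<delta>)"
  assumes H: "is_haar_orthogonal p H" and \<eta>: "\<eta> \<in> sparse_binary_vecs p r" and r: "0 < r"
    and a: "0 \<le> a" "a\<^sup>2 \<le> 1 / 2" "2 * (n * a\<^sup>2) / (p div r) \<le> 1 / 2"
    and \<xi>: "exp (r * (2 * (n * a\<^sup>2) / (p div r))) \<le> 1 + \<xi>" "\<xi> > 0"
    and \<phi>: "\<phi> \<in> tests n p"
  shows "1 - sqrt \<xi> \<le> type_I_error n p \<phi> + type_II_error n p H \<delta> \<eta> \<phi>"
proof -
  define S where "S = {k \<in> {..<p}. \<eta> k = 1}"
  have supp: "S \<subseteq> {..<p}" "card S = r"
    using sparse_binary_vecs_support[OF \<eta>] by (auto simp: S_def)
  have "r \<le> p" using card_mono[OF _ supp(1)] supp(2) by simp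
  then have pr: "p div r > 0" using r by (simp add: div_greater_zero_iff)
  obtain c where "\<And>j. j < p \<Longrightarrow> c j \<in> S" "\<And>s. s \<in> S \<Longrightarrow> c s = s"
    "\<And>s. s \<in> S \<Longrightarrow> p div r \<le> card {j \<in> {..<p}. c j = s}"
    using ex_block_assignment[OF supp r] by blast
  then interpret block_partition p S c "real (p div r)"
    using supp pr by unfold_locales auto
  let ?I = "{..<n} \<times> {..<p}"
  have \<phi>m [measurable]: "\<phi> \<in> borel_measurable (mat_space n p)" using \<phi> by (simp add: tests_def)
  have \<phi>01: "0 \<le> \<phi> x \<and> \<phi> x \<le> 1" if "x \<in> space (mat_space n p)" for x
    using \<phi> that by (simp add: tests_def)
  interpret N: prob_space "null_law n p"
    unfolding null_law_def gaussian_mat_def by (rule gauss.prob_space_axioms)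
  interpret M: prob_space "model n p H" by (rule prob_space_model[OF H])
  interpret A: prob_space "alternative_law n p H \<delta> \<eta>"
    unfolding alternative_law_def by (rule M.prob_space_distr[OF transmitted_measurable[OF H]])
  have sN: "sets (null_law n p) = sets (mat_space n p)"
    by (simp add: null_law_def gaussian_mat_def sets_gauss)
  have sA: "sets (alternative_law n p H \<delta> \<eta>) = sets (mat_space n p)"
    by (simp add: alternative_law_def)
  have int: "integrable R \<phi>" "AE x in R. 0 \<le> \<phi> x" if "prob_space R" "sets R = sets (mat_space n p)" for R
  proof -
    interpret R: prob_space R by fact
    have "\<phi> \<in> borel_measurable R" using that by (simp cong: measurable_cong_sets)
    moreover have *: "\<And>x. x \<in> space R \<Longrightarrow> 0 \<le> \<phi> x \<and> \<phi> x \<le> 1"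
      using \<phi>01 sets_eq_imp_space_eq[OF that(2)] by simp
    ultimately show "integrable R \<phi>"
      by (intro R.integrable_const_bound[where B = 1]) auto
    show "AE x in R. 0 \<le> \<phi> x" using * by auto
  qed
  have tr: "transmitted n p \<delta> \<eta> \<in> mat_space p p \<Otimes>\<^sub>M (mat_space n p \<Otimes>\<^sub>M mat_space n p) \<rightarrow>\<^sub>M mat_space n p"
    using transmitted_measurable[OF H, of n \<delta> \<eta>] sets_model[OF H, of n] by (simp cong: measurable_cong_sets)
  have "ennreal (LINT x|alternative_law n p H \<delta> \<eta>. \<phi> x) = (\<integral>\<^sup>+x. ennreal (\<phi> x) \<partial>alternative_law n p H \<delta> \<eta>)"
    by (rule nn_integral_eq_integral[symmetric]) (intro int A.prob_space_axioms sA)+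
  also have "\<dots> = (\<integral>\<^sup>+\<omega>. ennreal (\<phi> (transmitted n p \<delta> \<eta> \<omega>)) \<partial>model n p H)"
    unfolding alternative_law_def by (subst nn_integral_distr[OF transmitted_measurable[OF H]]) auto
  also have "\<dots> = (\<integral>\<^sup>+Q. \<integral>\<^sup>+z. \<integral>\<^sup>+x. ennreal (\<phi> (\<lambda>ij\<in>?I. x ij + signal a S Q z ij)) \<partial>gauss ?I \<partial>gauss ?I \<partial>H)"
    using measurable_compose[OF tr \<phi>m]
    by (subst nn_integral_model[OF H]) (auto simp: transmitted_eq_signal a_def S_def)
  also have "\<dots> \<le> (\<integral>\<^sup>+x. ennreal (\<phi> x) \<partial>gauss ?I) + ennreal (sqrt \<xi>)"
    by (rule haar_signal_test_le[OF H a _ \<xi>(2) \<phi>]) (simp only: supp(2) \<xi>(1))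
  also have "(\<integral>\<^sup>+x. ennreal (\<phi> x) \<partial>gauss ?I) = ennreal (LINT x|null_law n p. \<phi> x)"
    using nn_integral_eq_integral[OF int(1,2)[OF N.prob_space_axioms sN]]
    by (simp add: null_law_def gaussian_mat_def)
  finally have "ennreal (LINT x|alternative_law n p H \<delta> \<eta>. \<phi> x) \<le> ennreal ((LINT x|null_law n p. \<phi> x) + sqrt \<xi>)"
    using \<xi>(2) int(2)[OF N.prob_space_axioms sN] by (subst ennreal_plus) (auto intro!: integral_nonneg_AE)
  then have "(LINT x|alternative_law n p H \<delta> \<eta>. \<phi> x) \<le> (LINT x|null_law n p. \<phi> x) + sqrt \<xi>"
    using \<xi>(2) int(2)[OF N.prob_space_axioms sN]
    by (subst (asm) ennreal_le_iff) (auto intro!: add_nonneg_nonneg integral_nonneg_AE)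
  moreover have "type_II_error n p H \<delta> \<eta> \<phi> = 1 - (LINT x|alternative_law n p H \<delta> \<eta>. \<phi> x)"
    unfolding type_II_error_def using int(1)[OF A.prob_space_axioms sA] by (simp add: A.prob_space)
  ultimately show ?thesis by (simp add: type_I_error_def)
qed

subsection \<open>Decoding by likelihood ratios\<close>

definition energy :: "nat \<Rightarrow> nat \<Rightarrow> (nat \<times> nat \<Rightarrow> real) \<Rightarrow> nat \<Rightarrow> (nat \<times> nat \<Rightarrow> real) \<Rightarrow> real" where
  "energy n p Q k X = (\<Sum>i<n. (\<Sum>j<p. X (i, j) * Q (j, k))\<^sup>2)"

text \<open>The density, relative to white noise, of \<open>n\<close> independent vectors with
  covariance \<open>I + a q q^T\<close>, where \<open>q\<close> is the unit column \<open>k\<close>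
  of an orthogonal \<open>Q\<close>.\<close>

definition likelihood_ratio ::
  "nat \<Rightarrow> nat \<Rightarrow> real \<Rightarrow> (nat \<times> nat \<Rightarrow> real) \<Rightarrow> nat \<Rightarrow> (nat \<times> nat \<Rightarrow> real) \<Rightarrow> real" where
  "likelihood_ratio n p a Q k X = exp (a / (2 * (1 + a)) * energy n p Q k X) / sqrt (1 + a) ^ n"

definition likelihood_decoder ::
  "nat \<Rightarrow> nat \<Rightarrow> real \<Rightarrow> (nat \<times> nat \<Rightarrow> real) \<times> (nat \<times> nat \<Rightarrow> real) \<Rightarrow> nat \<Rightarrow> nat" where
  "likelihood_decoder n p a = (\<lambda>(X, Q). \<lambda>k\<in>{..<p}. if likelihood_ratio n p a Q k X > 1 then 1 else 0)"

text \<open>The Hellinger affinity of \<open>N(0, 1)\<close> and \<open>N(0, 1 + a)\<close>, that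
  is, the integral of the geometric mean of the two densities.\<close>

definition affinity :: "real \<Rightarrow> real" where
  "affinity a = sqrt (2 * sqrt (1 + a) / (2 + a))"

lemma measurable_likelihood_ratio [measurable (raw)]:
  assumes f: "f \<in> N \<rightarrow>\<^sub>M mat_space p p" and g: "g \<in> N \<rightarrow>\<^sub>M mat_space n p" and k: "k < p"
  shows "(\<lambda>x. likelihood_ratio n p a (f x) k (g x)) \<in> borel_measurable N"
proof -
  have [measurable]: "(\<lambda>x. f x (j, k)) \<in> borel_measurable N" "(\<lambda>x. g x (i, j)) \<in> borel_measurable N"
    if "i < n" "j < p" for i j
    using that k by (auto intro!: measurable_compose[OF f measurable_component_singleton]
      measurable_compose[OF g measurable_component_singleton])
  show ?thesis
    unfolding likelihood_ratio_def energy_def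
    by (intro borel_measurable_divide borel_measurable_const borel_measurable_exp borel_measurable_times
        borel_measurable_sum borel_measurable_power) auto
qed

lemma likelihood_decoder_in_binary_vecs: "likelihood_decoder n p a x \<in> binary_vecs p"
  by (cases x) (auto simp: likelihood_decoder_def binary_vecs_def)

lemma likelihood_decoder_eq_iff:
  assumes "\<eta> \<in> binary_vecs p"
  shows "likelihood_decoder n p a x = \<eta> \<longleftrightarrow>
    (\<forall>k\<in>{..<p}. (likelihood_ratio n p a (snd x) k (fst x) > 1) = (\<eta> k = 1))"
proof -
  have "likelihood_decoder n p a x = \<eta> \<longleftrightarrow> (\<forall>k\<in>{..<p}. likelihood_decoder n p a x k = \<eta> k)"
    using PiE_ext[OF likelihood_decoder_in_binary_vecs[unfolded binary_vecs_def] assms[unfolded binary_vecs_def]]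
    by blast
  also have "\<dots> \<longleftrightarrow> (\<forall>k\<in>{..<p}. (likelihood_ratio n p a (snd x) k (fst x) > 1) = (\<eta> k = 1))"
  proof (intro ball_cong refl)
    fix k assume k: "k \<in> {..<p}"
    then have "\<eta> k = 0 \<or> \<eta> k = 1" using assms by (auto simp: binary_vecs_def)
    then show "likelihood_decoder n p a x k = \<eta> k \<longleftrightarrow>
      (likelihood_ratio n p a (snd x) k (fst x) > 1) = (\<eta> k = 1)"
      using k by (auto simp: likelihood_decoder_def case_prod_beta)
  qed
  finally show ?thesis .
qed

lemma likelihood_decoder_in_decoders: "likelihood_decoder n p a \<in> decoders n p"
  unfolding decoders_def
proof (subst measurable_count_space_eq2)
  show "finite (binary_vecs p)" unfolding binary_vecs_def by (intro finite_PiE) auto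
  let ?M = "mat_space n p \<Otimes>\<^sub>M mat_space p p"
  have "likelihood_decoder n p a -` {\<eta>} \<inter> space ?M \<in> sets ?M" if "\<eta> \<in> binary_vecs p" for \<eta>
  proof -
    have "likelihood_decoder n p a -` {\<eta>} \<inter> space ?M =
      {x \<in> space ?M. \<forall>k\<in>{..<p}. (likelihood_ratio n p a (snd x) k (fst x) > 1) = (\<eta> k = 1)}"
      by (intro set_eqI) (simp add: likelihood_decoder_eq_iff[OF that] conj_commute)
    also have "\<dots> \<in> sets ?M"
      by (intro sets.sets_Collect_finite_All) (auto intro!: measurable_likelihood_ratio)
    finally show ?thesis .
  qed
  then show "likelihood_decoder n p a \<in> space ?M \<rightarrow> binary_vecs p \<and>
    (\<forall>\<eta>\<in>binary_vecs p. likelihood_decoder n p a -` {\<eta>} \<inter> space ?M \<in> sets ?M)"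
    using likelihood_decoder_in_binary_vecs by blast
qed

text \<open>The fourth power of the affinity is exactly \<open>1 - a^2 / (2 + a)^2\<close>, and
  \<open>2 + a \<le> 3\<close>. The constant is \<open>36 = 4 * 9\<close>.\<close>

lemma affinity_le_exp:
  assumes "0 \<le> a" "a \<le> 1"
  shows "affinity a \<le> exp (- a\<^sup>2 / 36)"
proof -
  have "(affinity a)\<^sup>2 = 2 * sqrt (1 + a) / (2 + a)" using assms by (simp add: affinity_def)
  then have "((affinity a)\<^sup>2)\<^sup>2 = (2 * sqrt (1 + a) / (2 + a))\<^sup>2" by simp
  also have "\<dots> = 4 * (1 + a) / (2 + a)\<^sup>2" using assms by (simp add: power_divide power_mult_distrib)
  also have "4 * (1 + a) = (2 + a)\<^sup>2 - a\<^sup>2" by (simp add: power2_eq_square algebra_simps)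
  also have "((2 + a)\<^sup>2 - a\<^sup>2) / (2 + a)\<^sup>2 = 1 - a\<^sup>2 / (2 + a)\<^sup>2"
    using assms by (simp add: diff_divide_distrib)
  also have "\<dots> \<le> 1 - a\<^sup>2 / 9"
  proof -
    have "(2 + a)\<^sup>2 \<le> 3\<^sup>2" using assms by (intro power_mono) auto
    then have "a\<^sup>2 / 9 \<le> a\<^sup>2 / (2 + a)\<^sup>2" using assms by (intro divide_left_mono) auto
    then show ?thesis by simp
  qed
  also have "\<dots> \<le> exp (- a\<^sup>2 / 9)" using exp_ge_add_one_self[of "- a\<^sup>2 / 9"] by simp
  also have "\<dots> = (exp (- a\<^sup>2 / 36)) ^ 4" by (simp flip: exp_of_nat_mult)
  finally have "affinity a ^ 4 \<le> (exp (- a\<^sup>2 / 36)) ^ 4" by (simp flip: power_mult)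
  then show ?thesis using assms by (subst (asm) power_mono_iff) (auto simp: affinity_def)
qed

text \<open>After the Cameron-Martin shift the exponent is quadratic in column \<open>k\<close> of
  \<open>z\<close>, and integrating \<open>z\<close> out yields the likelihood ratio. The other
  columns of \<open>z\<close> get coefficients \<open>b\<close> and \<open>d\<close> equal to zero
  and contribute a factor \<open>1\<close>.\<close>

lemma gauss_single_spike:
  assumes Q: "Q \<in> orthogonal_group p" and k: "k < p" and a: "a \<ge> 0"
    and f: "f \<in> borel_measurable (mat_space n p)"
  defines "I \<equiv> {..<n} \<times> {..<p}"
  shows "(\<integral>\<^sup>+z. \<integral>\<^sup>+x. f (\<lambda>(i, j)\<in>I. x (i, j) + sqrt a * z (i, k) * Q (j, k)) \<partial>gauss I \<partial>gauss I) =
    (\<integral>\<^sup>+x. f x * ennreal (likelihood_ratio n p a Q k x) \<partial>gauss I)"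
proof -
  interpret gg: pair_sigma_finite "gauss I" "gauss I" ..
  have I: "finite I" by (simp add: I_def)
  have fm [measurable]: "f \<in> borel_measurable (PiM I (\<lambda>_. borel))" using f by (simp add: I_def)
  have fm' [measurable]: "f \<in> borel_measurable (gauss I)" by measurable
  have q: "(\<Sum>j<p. (Q (j, k))\<^sup>2) = 1"
    using Q k by (auto simp: orthogonal_group_def power2_eq_square)
  define y where "y x i = (\<Sum>j<p. x (i, j) * Q (j, k))" for x :: "nat \<times> nat \<Rightarrow> real" and i
  define b where "b x = (\<lambda>(i::nat, k'). if k' = k then sqrt a * y x i else 0)" for x
  define d where "d = (\<lambda>(i::nat, k'). if k' = k then a else 0)"
  have ex: "(\<Sum>ij\<in>I. (case ij of (i, j) \<Rightarrow> sqrt a * z (i, k) * Q (j, k)) * x ij -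
        (case ij of (i, j) \<Rightarrow> sqrt a * z (i, k) * Q (j, k))\<^sup>2 / 2) =
      (\<Sum>ik\<in>I. b x ik * z ik - d ik * (z ik)\<^sup>2 / 2)" for x z
  proof -
    have "(\<Sum>ij\<in>I. (case ij of (i, j) \<Rightarrow> sqrt a * z (i, k) * Q (j, k)) * x ij -
        (case ij of (i, j) \<Rightarrow> sqrt a * z (i, k) * Q (j, k))\<^sup>2 / 2) =
      (\<Sum>i<n. \<Sum>j<p. sqrt a * z (i, k) * (x (i, j) * Q (j, k)) - a * (z (i, k))\<^sup>2 / 2 * (Q (j, k))\<^sup>2)"
      unfolding I_def sum.cartesian_product'
      using a by (intro sum.cong refl) (simp add: power_mult_distrib mult_ac)
    also have "\<dots> = (\<Sum>i<n. sqrt a * z (i, k) * y x i - a * (z (i, k))\<^sup>2 / 2)"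
      unfolding sum_subtractf sum_distrib_left[symmetric] q y_def[symmetric] by simp
    also have "\<dots> = (\<Sum>i<n. \<Sum>k'<p. if k' = k then sqrt a * z (i, k) * y x i - a * (z (i, k))\<^sup>2 / 2 else 0)"
      using k by simp
    also have "\<dots> = (\<Sum>ik\<in>I. b x ik * z ik - d ik * (z ik)\<^sup>2 / 2)"
      unfolding I_def sum.cartesian_product'
      by (intro sum.cong refl) (simp add: b_def d_def)
    finally show ?thesis .
  qed
  have lr: "(\<integral>\<^sup>+z. ennreal (exp (\<Sum>ik\<in>I. b x ik * z ik - d ik * (z ik)\<^sup>2 / 2)) \<partial>gauss I) =
    ennreal (likelihood_ratio n p a Q k x)" for x
  proof -
    have "(\<integral>\<^sup>+z. ennreal (exp (\<Sum>ik\<in>I. b x ik * z ik - d ik * (z ik)\<^sup>2 / 2)) \<partial>gauss I) =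
      ennreal (\<Prod>ik\<in>I. exp ((b x ik)\<^sup>2 / (2 * (1 + d ik))) / sqrt (1 + d ik))"
      using a by (intro gauss_exp_quadratic I) (auto simp: d_def)
    also have "(\<Prod>ik\<in>I. exp ((b x ik)\<^sup>2 / (2 * (1 + d ik))) / sqrt (1 + d ik)) =
      (\<Prod>i<n. \<Prod>k'<p. if k' = k then exp (a / (2 * (1 + a)) * (y x i)\<^sup>2) / sqrt (1 + a) else 1)"
      unfolding I_def prod.cartesian_product'
      using a by (intro prod.cong refl) (simp add: b_def d_def power_mult_distrib)
    also have "\<dots> = (\<Prod>i<n. exp (a / (2 * (1 + a)) * (y x i)\<^sup>2) / sqrt (1 + a))"
      using k by simp
    also have "\<dots> = likelihood_ratio n p a Q k x"
      by (simp add: likelihood_ratio_def energy_def y_def prod_dividef exp_sum sum_distrib_left)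
    finally show ?thesis .
  qed
  have ym: "(\<lambda>w. y (snd w) i) \<in> borel_measurable (gauss I \<Otimes>\<^sub>M gauss I)" if "i < n" for i
    unfolding y_def using that
    by (intro borel_measurable_sum borel_measurable_times borel_measurable_const) (auto simp: I_def)
  then have bm [measurable]: "(\<lambda>w. b (snd w) ik) \<in> borel_measurable (gauss I \<Otimes>\<^sub>M gauss I)" if "ik \<in> I" for ik
    using that by (auto simp: b_def I_def split: prod.splits)
  have "(\<integral>\<^sup>+z. \<integral>\<^sup>+x. f (\<lambda>(i, j)\<in>I. x (i, j) + sqrt a * z (i, k) * Q (j, k)) \<partial>gauss I \<partial>gauss I) =
    (\<integral>\<^sup>+z. \<integral>\<^sup>+x. f x * ennreal (exp (\<Sum>ik\<in>I. b x ik * z ik - d ik * (z ik)\<^sup>2 / 2)) \<partial>gauss I \<partial>gauss I)"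
  proof -
    have "(\<lambda>(i, j)\<in>I. x (i, j) + sqrt a * z (i, k) * Q (j, k)) =
      (\<lambda>ij\<in>I. x ij + (case ij of (i, j) \<Rightarrow> sqrt a * z (i, k) * Q (j, k)))" for x z
      by (auto simp: restrict_def fun_eq_iff)
    then show ?thesis by (simp only: gauss_shift[OF I fm] ex)
  qed
  also have "\<dots> = (\<integral>\<^sup>+x. \<integral>\<^sup>+z. f x * ennreal (exp (\<Sum>ik\<in>I. b x ik * z ik - d ik * (z ik)\<^sup>2 / 2)) \<partial>gauss I \<partial>gauss I)"
    by (rule gg.Fubini'[symmetric]) (unfold case_prod_beta, measurable)
  also have "\<dots> = (\<integral>\<^sup>+x. f x * ennreal (likelihood_ratio n p a Q k x) \<partial>gauss I)"
    unfolding lr[symmetric] by (intro nn_integral_cong nn_integral_cmult) measurable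
  finally show ?thesis .
qed

lemma nn_integral_sqrt_likelihood_ratio:
  assumes Q: "Q \<in> orthogonal_group p" and k: "k < p" and a: "a \<ge> 0"
  shows "(\<integral>\<^sup>+x. ennreal (sqrt (likelihood_ratio n p a Q k x)) \<partial>gauss ({..<n} \<times> {..<p})) = ennreal (affinity a ^ n)"
proof -
  let ?g = "gauss ({..<n} \<times> {..<p})"
  \<comment> \<open>Chosen so that \<open>a' / (1 + a')\<close> is half of
    \<open>a / (1 + a)\<close>. The square root of the ratio at strength \<open>a\<close> is then a
    constant multiple of the ratio at strength \<open>a'\<close>, which is a probability density;
    the constant is the claimed integral.\<close>
  define a' where "a' = a / (2 + a)"
  have a': "a' \<ge> 0" "1 + a' = 2 * (1 + a) / (2 + a)" "a' / (2 * (1 + a')) = a / (2 * (1 + a)) / 2"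
  proof -
    show "a' \<ge> 0" using a by (simp add: a'_def)
    show *: "1 + a' = 2 * (1 + a) / (2 + a)" using a by (simp add: a'_def field_simps)
    show "a' / (2 * (1 + a')) = a / (2 * (1 + a)) / 2"
      unfolding * using a by (simp add: a'_def)
  qed
  have aff: "affinity a = sqrt (1 + a') / sqrt (sqrt (1 + a))"
  proof -
    have "2 * sqrt (1 + a) / (2 + a) = (1 + a') / sqrt (1 + a)"
    proof -
      define s where "s = sqrt (1 + a)"
      have "s > 0" "1 + a = s * s" using a by (auto simp: s_def)
      then show ?thesis unfolding a'(2) s_def[symmetric] by simp
    qed
    then show ?thesis by (simp add: affinity_def real_sqrt_divide)
  qed
  have eq: "sqrt (likelihood_ratio n p a Q k x) = affinity a ^ n * likelihood_ratio n p a' Q k x" for x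
  proof -
    have "sqrt (exp t) = exp (t / 2)" for t :: real
      by (rule real_sqrt_unique) (auto simp flip: exp_double)
    then have "sqrt (likelihood_ratio n p a Q k x) = exp (a' / (2 * (1 + a')) * energy n p Q k x) / sqrt (sqrt (1 + a)) ^ n"
      unfolding a'(3) likelihood_ratio_def by (simp add: real_sqrt_divide real_sqrt_power)
    also have "\<dots> = affinity a ^ n * likelihood_ratio n p a' Q k x"
      unfolding aff likelihood_ratio_def using a'(1) by (simp add: power_divide)
    finally show ?thesis .
  qed
  have Qm: "Q \<in> space (mat_space p p)"
    using Q by (auto simp: orthogonal_group_def space_PiM PiE_def)
  have [measurable]: "likelihood_ratio n p a' Q k \<in> borel_measurable ?g"
    using measurable_likelihood_ratio[of "\<lambda>_. Q" ?g p "\<lambda>x. x" n k a'] Qm k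
      measurable_cong_sets[OF refl sets_gauss] by auto
  have "(\<integral>\<^sup>+x. ennreal (likelihood_ratio n p a' Q k x) \<partial>?g) = 1"
    using gauss_single_spike[OF Q k a'(1), of "\<lambda>_. 1" n] by (simp add: gauss.emeasure_space_1)
  moreover have "affinity a \<ge> 0" using a by (simp add: affinity_def)
  ultimately show ?thesis
    by (simp add: eq ennreal_mult' nn_integral_cmult)
qed

lemma energy_restrict:
  "energy n p Q k (\<lambda>ij\<in>{..<n} \<times> {..<p}. f ij) = energy n p Q k f"
  by (simp add: energy_def)

text \<open>The ratio depends on the data only through the projections on \<open>q_k\<close>, and by
  orthonormality the other spikes do not reach them. Thus the multi-spike model reduces to a single
  spike or to pure noise.\<close>

lemma likelihood_ratio_add_signal:
  assumes Q: "Q \<in> orthogonal_group p" and k: "k < p" and S: "S \<subseteq> {..<p}"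
  shows "likelihood_ratio n p b Q k (\<lambda>ij\<in>{..<n} \<times> {..<p}. x ij + signal a S Q z ij) =
    (if k \<in> S then likelihood_ratio n p b Q k (\<lambda>(i, j)\<in>{..<n} \<times> {..<p}. x (i, j) + sqrt a * z (i, k) * Q (j, k))
     else likelihood_ratio n p b Q k x)"
proof -
  have fin: "finite S" using S finite_subset by blast
  have "(\<Sum>j<p. signal a S Q z (i, j) * Q (j, k)) = (if k \<in> S then sqrt a * z (i, k) else 0)" for i
  proof -
    have "(\<Sum>j<p. signal a S Q z (i, j) * Q (j, k)) = (\<Sum>j<p. \<Sum>k'\<in>S. sqrt a * z (i, k') * (Q (j, k') * Q (j, k)))"
      by (simp add: signal_def sum_distrib_left sum_distrib_right mult_ac)
    also have "\<dots> = (\<Sum>k'\<in>S. \<Sum>j<p. sqrt a * z (i, k') * (Q (j, k') * Q (j, k)))" by (rule sum.swap)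
    also have "\<dots> = (\<Sum>k'\<in>S. if k' = k then sqrt a * z (i, k') else 0)"
      using Q k S unfolding sum_distrib_left[symmetric]
      by (intro sum.cong refl) (auto simp: orthogonal_group_def)
    finally show ?thesis using fin by simp
  qed
  moreover have "(\<Sum>j<p. sqrt a * z (i, k) * Q (j, k) * Q (j, k)) = sqrt a * z (i, k)" for i
    using Q k by (simp add: orthogonal_group_def mult.assoc flip: sum_distrib_left)
  ultimately show ?thesis
    unfolding likelihood_ratio_def energy_restrict by (simp add: energy_def distrib_right sum.distrib)
qed

text \<open>A missed spike costs \<open>L\<close> on the event \<open>L \<le> 1\<close> and a false
  alarm costs \<open>1\<close> on the event \<open>L > 1\<close>, with \<open>L\<close> the
  likelihood ratio under white noise. Both are at most \<open>sqrt L\<close>, whose integral is the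
  affinity.\<close>

lemma coordinate_error_le:
  fixes n p :: nat
  assumes Q: "Q \<in> orthogonal_group p" and k: "k < p" and S: "S \<subseteq> {..<p}" and a: "a \<ge> 0"
  defines "I \<equiv> {..<n} \<times> {..<p}"
  shows "(\<integral>\<^sup>+z. \<integral>\<^sup>+x. of_bool ((likelihood_ratio n p a Q k (\<lambda>ij\<in>I. x ij + signal a S Q z ij) > 1) \<noteq> (k \<in> S))
      \<partial>gauss I \<partial>gauss I) \<le> ennreal (affinity a ^ n)"
proof -
  have Qm [measurable]: "Q \<in> space (mat_space p p)"
    using Q by (auto simp: orthogonal_group_def space_PiM PiE_def)
  let ?L = "likelihood_ratio n p a Q k"
  have L [measurable]: "?L \<in> borel_measurable (mat_space n p)"
    using measurable_likelihood_ratio[of "\<lambda>_. Q" "mat_space n p" p "\<lambda>x. x" n k a] Qm k by auto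
  have L0: "?L x \<ge> 0" for x using a by (simp add: likelihood_ratio_def)
  show ?thesis
  proof (cases "k \<in> S")
    case True
    have "(\<integral>\<^sup>+z. \<integral>\<^sup>+x. of_bool ((?L (\<lambda>ij\<in>I. x ij + signal a S Q z ij) > 1) \<noteq> (k \<in> S)) \<partial>gauss I \<partial>gauss I) =
      (\<integral>\<^sup>+z. \<integral>\<^sup>+x. of_bool (\<not> ?L (\<lambda>(i, j)\<in>I. x (i, j) + sqrt a * z (i, k) * Q (j, k)) > 1) \<partial>gauss I \<partial>gauss I)"
      using True unfolding I_def likelihood_ratio_add_signal[OF Q k S] by simp
    also have "\<dots> = (\<integral>\<^sup>+x. of_bool (\<not> ?L x > 1) * ennreal (?L x) \<partial>gauss I)"
      unfolding I_def by (intro gauss_single_spike[OF Q k a]) measurable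
    also have "\<dots> \<le> (\<integral>\<^sup>+x. ennreal (sqrt (?L x)) \<partial>gauss I)"
    proof (rule nn_integral_mono)
      fix x
      show "of_bool (\<not> ?L x > 1) * ennreal (?L x) \<le> ennreal (sqrt (?L x))"
      proof (cases "?L x > 1")
        case False
        have "?L x = sqrt (?L x) * sqrt (?L x)" using L0[of x] by simp
        also have "\<dots> \<le> sqrt (?L x) * 1" using False L0[of x] by (intro mult_left_mono) auto
        finally show ?thesis using False by (simp add: ennreal_leI)
      qed simp
    qed
    finally show ?thesis unfolding I_def nn_integral_sqrt_likelihood_ratio[OF Q k a] .
  next
    case False
    have "(\<integral>\<^sup>+z. \<integral>\<^sup>+x. of_bool ((?L (\<lambda>ij\<in>I. x ij + signal a S Q z ij) > 1) \<noteq> (k \<in> S)) \<partial>gauss I \<partial>gauss I) =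
      (\<integral>\<^sup>+x. of_bool (?L x > 1) \<partial>gauss I)"
      using False unfolding I_def likelihood_ratio_add_signal[OF Q k S] by (simp add: gauss.emeasure_space_1)
    also have "\<dots> \<le> (\<integral>\<^sup>+x. ennreal (sqrt (?L x)) \<partial>gauss I)"
    proof (rule nn_integral_mono)
      fix x
      show "of_bool (?L x > 1) \<le> ennreal (sqrt (?L x))"
        by (auto simp: of_bool_def ennreal_1[symmetric] simp del: ennreal_1 intro!: ennreal_leI)
    qed
    finally show ?thesis unfolding I_def nn_integral_sqrt_likelihood_ratio[OF Q k a] .
  qed
qed

text \<open>A union bound over the coordinates, each error being bounded for almost every
  \<open>Q\<close>. The bound does not depend on \<open>\<eta>\<close>, so it passes to the
  infimum.\<close>

lemma success_prob_ge:
  fixes n p :: nat and \<delta> a :: real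
  defines "a \<equiv> \<delta> / (1 - \<delta>)"
  assumes H: "is_haar_orthogonal p H" and \<eta>: "\<eta> \<in> binary_vecs p" and a: "a \<ge> 0"
  shows "1 - p * affinity a ^ n \<le> success_prob n p H \<delta> (likelihood_decoder n p a) \<eta>"
proof -
  define S where "S = {k \<in> {..<p}. \<eta> k = 1}"
  have S: "S \<subseteq> {..<p}" by (auto simp: S_def)
  let ?M = "model n p H"
  interpret M: prob_space ?M by (rule prob_space_model[OF H])
  let ?P = "mat_space p p \<Otimes>\<^sub>M (mat_space n p \<Otimes>\<^sub>M mat_space n p)"
  have tr: "transmitted n p \<delta> \<eta> \<in> ?P \<rightarrow>\<^sub>M mat_space n p"
    using transmitted_measurable[OF H, of n \<delta> \<eta>] sets_model[OF H, of n] by (simp cong: measurable_cong_sets)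
  define wrong where "wrong k \<omega> = ((likelihood_ratio n p a (fst \<omega>) k (transmitted n p \<delta> \<eta> \<omega>) > 1) \<noteq> (k \<in> S))" for k \<omega>
  have wm: "Measurable.pred ?P (wrong k)" if "k < p" for k
  proof -
    have "(\<lambda>\<omega>. likelihood_ratio n p a (fst \<omega>) k (transmitted n p \<delta> \<eta> \<omega>)) \<in> borel_measurable ?P"
      by (rule measurable_likelihood_ratio[OF _ tr that]) measurable
    then show ?thesis unfolding wrong_def by measurable
  qed
  define E where "E k = {\<omega> \<in> space ?M. wrong k \<omega>}" for k
  have spM: "space ?M = space ?P" by (rule sets_eq_imp_space_eq[OF sets_model[OF H]])
  have Es: "E k \<in> sets ?M" if "k < p" for k
    using wm[OF that] unfolding E_def spM sets_model[OF H] by measurable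
  have E_le: "measure ?M (E k) \<le> affinity a ^ n" if k: "k < p" for k
  proof -
    have "emeasure ?M (E k) = (\<integral>\<^sup>+\<omega>. indicator (E k) \<omega> \<partial>?M)" using Es[OF k] by simp
    also have "\<dots> = (\<integral>\<^sup>+\<omega>. of_bool (wrong k \<omega>) \<partial>?M)"
      by (intro nn_integral_cong) (auto simp: E_def indicator_def)
    also have "\<dots> = (\<integral>\<^sup>+Q. \<integral>\<^sup>+z. \<integral>\<^sup>+x. of_bool (wrong k (Q, z, x))
        \<partial>gauss ({..<n} \<times> {..<p}) \<partial>gauss ({..<n} \<times> {..<p}) \<partial>H)"
      using wm[OF k] by (intro nn_integral_model[OF H]) measurable
    also have "\<dots> \<le> (\<integral>\<^sup>+Q. ennreal (affinity a ^ n) \<partial>H)"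
    proof (rule nn_integral_mono_AE)
      have "AE Q in H. Q \<in> orthogonal_group p" using H by (simp add: is_haar_orthogonal_def)
      then show "AE Q in H. (\<integral>\<^sup>+z. \<integral>\<^sup>+x. of_bool (wrong k (Q, z, x))
        \<partial>gauss ({..<n} \<times> {..<p}) \<partial>gauss ({..<n} \<times> {..<p})) \<le> ennreal (affinity a ^ n)"
      proof eventually_elim
        case (elim Q)
        show ?case
          unfolding wrong_def transmitted_eq_signal fst_conv S_def[symmetric] a_def[symmetric]
          by (rule coordinate_error_le[OF elim k S a])
      qed
    qed
    also have "\<dots> = ennreal (affinity a ^ n)"
      using H by (simp add: is_haar_orthogonal_def prob_space.emeasure_space_1)
    finally show ?thesis
      using a by (simp add: M.emeasure_eq_measure affinity_def)
  qed
  have "{\<omega> \<in> space ?M. likelihood_decoder n p a (transmitted n p \<delta> \<eta> \<omega>, fst \<omega>) = \<eta>} = space ?M - (\<Union>k<p. E k)"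
    by (auto simp: likelihood_decoder_eq_iff[OF \<eta>] E_def wrong_def S_def)
  then have "success_prob n p H \<delta> (likelihood_decoder n p a) \<eta> = 1 - measure ?M (\<Union>k<p. E k)"
    using Es by (simp add: success_prob_def M.prob_compl)
  moreover have "measure ?M (\<Union>k<p. E k) \<le> (\<Sum>k<p. measure ?M (E k))"
    using Es by (intro M.finite_measure_subadditive_finite) auto
  moreover have "\<dots> \<le> (\<Sum>k<p. affinity a ^ n)" by (intro sum_mono E_le) simp
  ultimately show ?thesis by simp
qed

subsection \<open>Asymptotics\<close>

text \<open>Guards against the infimum of an empty set of reals, whose value is unspecified.\<close>

lemma sparse_binary_vecs_nonempty:
  assumes "r \<le> p"
  shows "sparse_binary_vecs p r \<noteq> {}"
proof -
  define \<eta> where "\<eta> = (\<lambda>k\<in>{..<p}. if k < r then 1 else 0 :: nat)"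
  have "{k \<in> {..<p}. \<eta> k \<noteq> 0} = {..<r}" using assms by (auto simp: \<eta>_def)
  then have "\<eta> \<in> sparse_binary_vecs p r"
    by (simp add: sparse_binary_vecs_def binary_vecs_def) (simp add: \<eta>_def)
  then show ?thesis by blast
qed

lemma success_prob_bounds:
  assumes "is_haar_orthogonal p H"
  shows "0 \<le> success_prob n p H \<delta> dec \<eta>" "success_prob n p H \<delta> dec \<eta> \<le> 1"
  using prob_space.prob_le_1[OF prob_space_model[OF assms]] by (auto simp: success_prob_def)

lemma Inf_success_prob_bounds:
  fixes n p :: nat
  assumes H: "is_haar_orthogonal p H" and r: "r \<le> p" and a: "\<delta> / (1 - \<delta>) \<ge> 0"
  defines "I \<equiv> (INF \<eta> \<in> sparse_binary_vecs p r.
    success_prob n p H \<delta> (likelihood_decoder n p (\<delta> / (1 - \<delta>))) \<eta>)"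
  shows "1 - p * affinity (\<delta> / (1 - \<delta>)) ^ n \<le> I" "I \<le> 1"
proof -
  show "1 - p * affinity (\<delta> / (1 - \<delta>)) ^ n \<le> I"
    unfolding I_def using sparse_binary_vecs_nonempty[OF r] success_prob_ge[OF H _ a]
    by (intro cINF_greatest) (auto simp: sparse_binary_vecs_def)
  obtain \<eta> where "\<eta> \<in> sparse_binary_vecs p r" using sparse_binary_vecs_nonempty[OF r] by blast
  then show "I \<le> 1"
    unfolding I_def using success_prob_bounds[OF H]
    by (intro cINF_lower2[where x = \<eta>]) (auto intro!: bdd_belowI[where m = 0])
qed

lemma Inf_errors_bounds:
  assumes H: "is_haar_orthogonal p H"
    and ge: "\<And>\<phi>. \<phi> \<in> tests n p \<Longrightarrow> l \<le> type_I_error n p \<phi> + type_II_error n p H \<delta> \<eta> \<phi>"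
  defines "I \<equiv> (INF \<phi> \<in> tests n p. type_I_error n p \<phi> + type_II_error n p H \<delta> \<eta> \<phi>)"
  shows "l \<le> I" "I \<le> 1"
proof -
  \<comment> \<open>Never rejecting has errors \<open>0\<close> and \<open>1\<close>, which caps the
    infimum at \<open>1\<close>.\<close>
  have 0: "(\<lambda>_. 0) \<in> tests n p" by (simp add: tests_def)
  show "l \<le> I" unfolding I_def using ge 0 by (intro cINF_greatest) auto
  interpret prob_space "alternative_law n p H \<delta> \<eta>"
    unfolding alternative_law_def
    by (rule prob_space.prob_space_distr[OF prob_space_model[OF H] transmitted_measurable[OF H]])
  have "type_I_error n p (\<lambda>_. 0) + type_II_error n p H \<delta> \<eta> (\<lambda>_. 0) = 1"
    by (simp add: type_I_error_def type_II_error_def prob_space)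
  then show "I \<le> 1"
    unfolding I_def using ge 0
    by (intro cINF_lower2[where x = "\<lambda>_. 0"]) (auto intro!: bdd_belowI[where m = l])
qed

lemma spike_strength_bounds:
  fixes \<delta> :: real
  assumes "0 \<le> \<delta>" "\<delta> \<le> 1 / 4"
  shows "\<delta> \<le> \<delta> / (1 - \<delta>)" "\<delta> / (1 - \<delta>) \<le> 2 * \<delta>"
proof -
  have "\<delta> * (1 - \<delta>) \<le> \<delta>" using assms by (intro mult_right_le_one_le) auto
  then show "\<delta> \<le> \<delta> / (1 - \<delta>)" using assms by (simp add: pos_le_divide_eq)
  have "\<delta> * 1 \<le> \<delta> * (2 * (1 - \<delta>))" using assms by (intro mult_left_mono) auto
  then show "\<delta> / (1 - \<delta>) \<le> 2 * \<delta>" using assms by (simp add: pos_divide_le_eq mult_ac)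
qed

lemma tends_to_1_squeeze:
  fixes f g :: "nat \<Rightarrow> real"
  assumes "eventually (\<lambda>n. 1 - g n \<le> f n \<and> f n \<le> 1) sequentially" "g \<longlonglongrightarrow> 0"
  shows "f \<longlonglongrightarrow> 1"
proof (rule tendsto_sandwich)
  show "(\<lambda>n. 1 - g n) \<longlonglongrightarrow> 1" using tendsto_diff[OF tendsto_const assms(2)] by simp
  show "\<forall>\<^sub>F n in sequentially. 1 - g n \<le> f n" "\<forall>\<^sub>F n in sequentially. f n \<le> 1"
    using assms(1) by (auto elim: eventually_mono)
qed simp

text \<open>Rounding down loses at most a factor two:
  \<open>p < (p div r + 1) * r \<le> 2 * (p div r) * r\<close>. With \<open>n \<le> p\<close> this
  gives \<open>n / (p div r) \<le> 2 * r\<close>, and the other factor \<open>2\<close> is already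
  in the exponent.\<close>

lemma block_exponent_le:
  fixes n p r :: nat and a :: real
  assumes "n \<le> p" "0 < r" "r \<le> p"
  shows "r * (2 * (n * a\<^sup>2) / (p div r)) \<le> 4 * (r * a)\<^sup>2"
proof -
  have m: "p div r > 0" using assms by (simp add: div_greater_zero_iff)
  have "p < Suc (p div r) * r" using dividend_less_div_times[OF assms(2), of p] by simp
  also have "\<dots> \<le> (2 * (p div r)) * r" using m by (intro mult_right_mono) auto
  finally have "real n \<le> real (2 * (p div r) * r)" using assms(1) by (simp only: of_nat_le_iff)
  then have "n / real (p div r) \<le> 2 * r" using m by (simp add: pos_divide_le_eq mult_ac)
  then have "2 * r * a\<^sup>2 * (n / real (p div r)) \<le> 2 * r * a\<^sup>2 * (2 * r)" by (intro mult_left_mono) auto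
  then show ?thesis by (simp add: power2_eq_square mult_ac)
qed

theorem theorem1p7:
  fixes \<alpha> \<beta> \<gamma> :: real
    and p r :: "nat \<Rightarrow> nat"
    and \<delta> :: "nat \<Rightarrow> real"
    and H :: "nat \<Rightarrow> (nat \<times> nat \<Rightarrow> real) measure"
  assumes "0 < \<alpha>" "\<alpha> < 1" "0 < \<beta>" "\<beta> < 1" "\<gamma> \<ge> 1"
    and "1 / 2 < \<beta>"
    and "1 - \<beta> < \<alpha>" "\<alpha> < 1 / 2"
    and "\<And>n. p n \<ge> n"
    and "(\<lambda>n. real (p n) / real n) \<longlonglongrightarrow> \<gamma>"
    and "\<And>n. int (r n) = \<lfloor>real n powr (1 - \<beta>)\<rfloor> \<or> int (r n) = \<lceil>real n powr (1 - \<beta>)\<rceil>"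
    and "\<And>n. \<delta> n = real n powr (- \<alpha>)"
    and "\<And>n. is_haar_orthogonal (p n) (H n)"
  shows
    "(\<exists>dec. (\<forall>n. dec n \<in> decoders n (p n)) \<and>
        (\<lambda>n. INF \<eta> \<in> sparse_binary_vecs (p n) (r n).
           success_prob n (p n) (H n) (\<delta> n) (dec n) \<eta>) \<longlonglongrightarrow> 1)
     \<and>
     (\<forall>\<eta>. (\<forall>n. \<eta> n \<in> sparse_binary_vecs (p n) (r n)) \<longrightarrow>
        (\<lambda>n. INF \<phi> \<in> tests n (p n).
           type_I_error n (p n) \<phi> + type_II_error n (p n) (H n) (\<delta> n) (\<eta> n) \<phi>) \<longlonglongrightarrow> 1)"
proof -
  note \<alpha> = \<open>0 < \<alpha>\<close> \<open>\<alpha> < 1 / 2\<close> and \<alpha>\<beta> = \<open>1 - \<beta> < \<alpha>\<close> and p = \<open>\<And>n. p n \<ge> n\<close>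
    and \<delta> = \<open>\<And>n. \<delta> n = real n powr (- \<alpha>)\<close> and H = \<open>\<And>n. is_haar_orthogonal (p n) (H n)\<close>
  define a where "a n = \<delta> n / (1 - \<delta> n)" for n
  have "\<delta> \<longlonglongrightarrow> 0" unfolding \<delta>[abs_def] using \<alpha> by real_asymp
  then have "eventually (\<lambda>n. \<delta> n < 1 / 4) sequentially" by (rule order_tendstoD) simp
  then have ev_a: "eventually (\<lambda>n. \<delta> n \<le> a n \<and> a n \<le> 2 * \<delta> n \<and> a n \<le> 1 / 2) sequentially"
  proof eventually_elim
    case (elim n)
    then show ?case using spike_strength_bounds[of "\<delta> n"] by (simp add: a_def) (simp add: \<delta>)
  qed
  have \<delta>0: "\<delta> n \<ge> 0" for n by (simp add: \<delta>)
  \<comment> \<open>For positive \<open>n\<close> the power lies between \<open>1\<close> and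
    \<open>n\<close>, so rounding in either direction keeps \<open>r n\<close> in this range and
    costs at most a factor \<open>2\<close>.\<close>
  have r: "0 < r n" "r n \<le> n" "r n \<le> 2 * real n powr (1 - \<beta>)" if n: "n > 0" for n
  proof -
    have 1: "1 \<le> real n powr (1 - \<beta>)" using n \<open>\<beta> < 1\<close> by (intro ge_one_powr_ge_zero) auto
    have "real n powr (1 - \<beta>) \<le> real n powr 1" using n \<open>0 < \<beta>\<close> by (intro powr_mono) auto
    then have 2: "real n powr (1 - \<beta>) \<le> n" using n by simp
    have *: "1 \<le> \<lfloor>real n powr (1 - \<beta>)\<rfloor>" "\<lceil>real n powr (1 - \<beta>)\<rceil> \<le> int n"
      using 1 2 by (auto simp: le_floor_iff ceiling_le_iff)
    have **: "\<lfloor>real n powr (1 - \<beta>)\<rfloor> \<le> \<lceil>real n powr (1 - \<beta>)\<rceil>" by (rule floor_le_ceiling)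
    show "0 < r n" "r n \<le> n" using assms(11)[of n] * ** by linarith+
    have "real (r n) \<le> real_of_int \<lceil>real n powr (1 - \<beta>)\<rceil>" using assms(11)[of n] ** by linarith
    also have "\<dots> \<le> real n powr (1 - \<beta>) + 1" by linarith
    finally show "r n \<le> 2 * real n powr (1 - \<beta>)" using 1 by linarith
  qed
  have ev_p: "eventually (\<lambda>n. p n \<le> (\<gamma> + 1) * n) sequentially"
  proof -
    have "eventually (\<lambda>n. p n / n < \<gamma> + 1) sequentially"
      using assms(10) by (rule order_tendstoD) simp
    then show ?thesis using eventually_gt_at_top[of 0]
      by eventually_elim (simp add: pos_divide_less_eq less_imp_le)
  qed
  show ?thesis
  proof (intro conjI allI impI exI[where x = "\<lambda>n. likelihood_decoder n (p n) (a n)"])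
    show "likelihood_decoder n (p n) (a n) \<in> decoders n (p n)" for n
      by (rule likelihood_decoder_in_decoders)
    \<comment> \<open>The union bound with \<open>p n\<close> replaced by
      \<open>(\<gamma> + 1) * n\<close> and \<open>n * (a n)^2\<close> by its lower bound
      \<open>n powr (1 - 2 * \<alpha>)\<close>. As \<alpha> is below \<open>1 / 2\<close>, the
      exponential beats the linear factor.\<close>
    define g where "g n = (\<gamma> + 1) * n * exp (- (real n powr (1 - 2 * \<alpha>)) / 36)" for n
    show "(\<lambda>n. INF \<eta> \<in> sparse_binary_vecs (p n) (r n).
      success_prob n (p n) (H n) (\<delta> n) (likelihood_decoder n (p n) (a n)) \<eta>) \<longlonglongrightarrow> 1"
    proof (rule tends_to_1_squeeze)
      show "g \<longlonglongrightarrow> 0" unfolding g_def[abs_def] using \<alpha> \<open>\<gamma> \<ge> 1\<close> by real_asymp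
      show "eventually (\<lambda>n. 1 - g n \<le> (INF \<eta> \<in> sparse_binary_vecs (p n) (r n).
        success_prob n (p n) (H n) (\<delta> n) (likelihood_decoder n (p n) (a n)) \<eta>) \<and>
        (INF \<eta> \<in> sparse_binary_vecs (p n) (r n).
        success_prob n (p n) (H n) (\<delta> n) (likelihood_decoder n (p n) (a n)) \<eta>) \<le> 1) sequentially"
        using ev_a ev_p eventually_gt_at_top[of 0]
      proof eventually_elim
        case (elim n)
        have a0: "0 \<le> a n" using elim \<delta>0[of n] by linarith
        have "affinity (a n) ^ n \<le> exp (- (a n)\<^sup>2 / 36) ^ n"
          using elim a0 by (intro power_mono affinity_le_exp) (auto simp: affinity_def)
        also have "\<dots> = exp (- (n * (a n)\<^sup>2) / 36)" by (simp flip: exp_of_nat_mult)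
        also have "\<dots> \<le> exp (- (real n powr (1 - 2 * \<alpha>)) / 36)"
        proof -
          have "real n powr (1 - 2 * \<alpha>) = n * (\<delta> n)\<^sup>2"
            using elim by (simp add: \<delta> powr_diff powr_minus powr_mult_base power2_eq_square field_simps
                flip: powr_add)
          also have "\<dots> \<le> n * (a n)\<^sup>2" using elim \<delta>0 by (intro mult_left_mono power_mono) auto
          finally show ?thesis by simp
        qed
        finally have "p n * affinity (a n) ^ n \<le> g n"
          unfolding g_def using elim a0 by (intro mult_mono) (auto simp: affinity_def)
        moreover have "r n \<le> p n" using r(2)[of n] p[of n] elim by simp
        ultimately show ?case
          using Inf_success_prob_bounds[OF H, of "r n" n "\<delta> n" n] a0 by (simp add: a_def)
      qed
    qed
  next
    fix \<eta> assume \<eta>: "\<forall>n. \<eta> n \<in> sparse_binary_vecs (p n) (r n)"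
    \<comment> \<open>From \<open>4 * (r n * a n)^2\<close> with
      \<open>r n \<le> 2 * n powr (1 - \<beta>)\<close> and
      \<open>a n \<le> 2 * n powr (- \<alpha>)\<close>; hence
      \<open>64 = 4 * (2 * 2)^2\<close>.\<close>
    define x where "x n = 64 * real n powr (2 * (1 - \<beta> - \<alpha>))" for n
    define \<xi> where "\<xi> n = exp (x n) - 1" for n
    have x0: "x \<longlonglongrightarrow> 0" unfolding x_def[abs_def] using \<alpha>\<beta> by real_asymp
    then have "(\<lambda>n. sqrt (exp (x n) - 1)) \<longlonglongrightarrow> sqrt (exp 0 - 1)" by (intro tendsto_intros)
    then have \<xi>0: "(\<lambda>n. sqrt (\<xi> n)) \<longlonglongrightarrow> 0" by (simp add: \<xi>_def)
    have "eventually (\<lambda>n. x n < 1 / 2) sequentially" using x0 by (rule order_tendstoD) simp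
    then have "eventually (\<lambda>n. 1 - sqrt (\<xi> n) \<le> (INF \<phi> \<in> tests n (p n).
           type_I_error n (p n) \<phi> + type_II_error n (p n) (H n) (\<delta> n) (\<eta> n) \<phi>) \<and>
      (INF \<phi> \<in> tests n (p n).
           type_I_error n (p n) \<phi> + type_II_error n (p n) (H n) (\<delta> n) (\<eta> n) \<phi>) \<le> 1) sequentially"
      using ev_a eventually_gt_at_top[of 0]
    proof eventually_elim
      case (elim n)
      have a0: "0 \<le> a n" using elim \<delta>0[of n] by linarith
      have rn: "0 < r n" "r n \<le> p n" using r[of n] p[of n] elim by auto
      have "r n * (2 * (n * (a n)\<^sup>2) / (p n div r n)) \<le> 4 * (r n * a n)\<^sup>2"
        by (rule block_exponent_le[OF p rn])
      also have "\<dots> \<le> 4 * (2 * real n powr (1 - \<beta>) * (2 * \<delta> n))\<^sup>2"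
        using elim r(3)[of n] a0 by (intro mult_left_mono power_mono mult_mono) auto
      also have "\<dots> = x n"
      proof -
        have "(real n powr (1 - \<beta>) * \<delta> n)\<^sup>2 = real n powr (2 * (1 - \<beta> - \<alpha>))"
          unfolding \<delta> power2_eq_square by (simp add: algebra_simps flip: powr_add)
        then show ?thesis by (simp add: x_def power_mult_distrib)
      qed
      finally have le: "r n * (2 * (n * (a n)\<^sup>2) / (p n div r n)) \<le> x n" .
      \<comment> \<open>Since \<open>r n\<close> is at least \<open>1\<close>, the exponent of a
        single block is bounded by the total exponent, so \<open>x n < 1 / 2\<close> also supplies
        the smallness condition of the second moment bound.\<close>
      have "1 * (2 * (n * (a n)\<^sup>2) / (p n div r n)) \<le> r n * (2 * (n * (a n)\<^sup>2) / (p n div r n))"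
        using rn by (intro mult_right_mono) auto
      then have le': "2 * (n * (a n)\<^sup>2) / (p n div r n) \<le> 1 / 2" using le elim by linarith
      have "(a n)\<^sup>2 \<le> (1 / 2)\<^sup>2" using elim a0 by (intro power_mono) auto
      then have a2: "(a n)\<^sup>2 \<le> 1 / 2" by (simp add: power2_eq_square)
      have "0 < x n" using elim by (simp add: x_def)
      then have "\<xi> n > 0" by (simp add: \<xi>_def)
      moreover have "exp (r n * (2 * (n * (a n)\<^sup>2) / (p n div r n))) \<le> 1 + \<xi> n"
        using le by (simp add: \<xi>_def)
      ultimately show ?case
        using sum_of_errors_ge[OF H spec[OF \<eta>, of n] rn(1), of "\<delta> n" n "\<xi> n"] a0 a2 le'
        by (intro conjI Inf_errors_bounds[OF H, where l = "1 - sqrt (\<xi> n)"]) (auto simp: a_def)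
    qed
    then show "(\<lambda>n. INF \<phi> \<in> tests n (p n).
           type_I_error n (p n) \<phi> + type_II_error n (p n) (H n) (\<delta> n) (\<eta> n) \<phi>) \<longlonglongrightarrow> 1"
      using \<xi>0 by (rule tends_to_1_squeeze)
  qed
qed

end
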